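(* Let $(K,\mathrm{dist})$ be a compact metric space and let $f:K\to K$ be a surjective continuous mapping having the ergodic inverse shadowing property (EIS). Then the set of Borel probability invariant measures of $f$ is weakly continuous, i.e., for any $\varepsilon>0$ there exists a $d>0$ such that if $g=\{g_k\}_{k\in\mathbb{Z}_+}$ is a $d$-method for $f$, then $\mathcal{M}(f)\subset U_\varepsilon(\mathcal{M}(g))$.
   Context: $\mathbb{Z}_+=\{0,1,2,\dots\}$. $C(K,K)$ is the space of continuous mappings $K\to K$ with the metric $\mathrm{dist}_{C^0}(g,h)=\max_{x\in K}\mathrm{dist}(g(x),h(x))$. A method is a sequence $g=\{g_k\in C(K,K)\}_{k\in\mathbb{Z}_+}$; a trajectory of $g$ is a sequence $\{y_k\}_{k\in\mathbb{Z}_+}$ in $K$ with $y_{k+1}=g_k(y_k)$ for all $k$. For $d>0$, the method $g$ is a $d$-method for $f$ if $\mathrm{dist}_{C^0}(g_k,f)\le d$ for all $k\in\mathbb{Z}_+$. $\mathrm{Lip}_1$ is the set of functions $\varphi:K\to\mathbb{R}$ that are Lipschitz with constant at most $1$. A surjective continuous mapping $f:K\to K$ has the ergodic inverse shadowing property (EIS) if for any $\varepsilon>0$ there exists a $d>0$ such that for any trajectory $\{x_k=f^k(x):k\in\mathbb{Z}_+\}$ of $f$ and for any $d$-method $g$ for $f$ there exists a trajectory $\{y_k:k\in\mathbb{Z}_+\}$ of $g$ such that $\limsup_{n\to\infty}\frac1n\sum_{k=1}^n(\varphi(x_k)-\varphi(y_k))\le\varepsilon$ for every $\varphi\in\mathrm{Lip}_1$.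 $\mathcal{M}$ is the set of all Borel probability measures on $K$ with the weak-$*$ topology, metrized by the Kantorovich--Wasserstein metric $W_1(\mu_1,\mu_2)=\sup_{\varphi\in\mathrm{Lip}_1}\left|\int_K\varphi\,d\mu_1-\int_K\varphi\,d\mu_2\right|$. For $A\subset\mathcal{M}$, $U_\varepsilon(A)$ is the $\varepsilon$-neighbourhood of $A$ with respect to $W_1$. $\mathcal{M}(f)$ denotes the set of $f$-invariant Borel probability measures on $K$. For a method $g=\{g_k\}$, put $g_0^k=g_{k-1}\circ\cdots\circ g_0$ (with $g_0^0=\mathrm{id}$). For $x\in K$, $\mathcal{M}_0(g,x)$ is the set of limit points in $\mathcal{M}$ of the sequence $\frac1N\sum_{k=0}^{N-1}\delta(g_0^k(x))$, i.e. $\mathcal{M}_0(g,x)=\bigcap_{n\ge1}\overline{\left\{\frac1N\sum_{k=0}^{N-1}\delta(g_0^k(x)):N\ge n\right\}}$, where $\delta(y)$ is the Dirac measure at $y$. Further, $\mathcal{M}_0(g)=\bigcup_{x\in K}\mathcal{M}_0(g,x)$ and $\mathcal{M}(g)=\overline{\mathrm{conv}\,\mathcal{M}_0(g)}$ (closed convex hull). *)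

theory Defs
  imports "HOL-Probability.Probability"
begin

text \<open>
  The compact metric space \<open>K\<close> is a type \<open>'a\<close> of class \<open>metric_space\<close>; compactness of
  \<open>UNIV :: 'a set\<close> is a hypothesis of the theorem, not part of the definitions.
\<close>

text \<open>
  On a compact space the supremum of the continuous function \<open>\<lambda>x. dist (g x) (h x)\<close> is a maximum.
\<close>

definition dist_C0 :: "('a::metric_space \<Rightarrow> 'a) \<Rightarrow> ('a \<Rightarrow> 'a) \<Rightarrow> real" where
  "dist_C0 g h = (SUP x. dist (g x) (h x))"

definition is_method :: "(nat \<Rightarrow> 'a::metric_space \<Rightarrow> 'a) \<Rightarrow> bool" where
  "is_method g \<longleftrightarrow> (\<forall>k. continuous_on UNIV (g k))"

definition is_d_method :: "real \<Rightarrow> ('a::metric_space \<Rightarrow> 'a) \<Rightarrow> (nat \<Rightarrow> 'a \<Rightarrow> 'a) \<Rightarrow> bool" where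
  "is_d_method d f g \<longleftrightarrow> is_method g \<and> (\<forall>k. dist_C0 (g k) f \<le> d)"

definition trajectory :: "(nat \<Rightarrow> 'a \<Rightarrow> 'a) \<Rightarrow> (nat \<Rightarrow> 'a) \<Rightarrow> bool" where
  "trajectory g y \<longleftrightarrow> (\<forall>k. y (Suc k) = g k (y k))"

primrec comp_upto :: "(nat \<Rightarrow> 'a \<Rightarrow> 'a) \<Rightarrow> nat \<Rightarrow> 'a \<Rightarrow> 'a" where
  "comp_upto g 0 = id"
| "comp_upto g (Suc k) = g k \<circ> comp_upto g k"

definition Lip1 :: "('a::metric_space \<Rightarrow> real) set" where
  "Lip1 = {\<phi>. 1-lipschitz_on UNIV \<phi>}"

definition EIS :: "('a::metric_space \<Rightarrow> 'a) \<Rightarrow> bool" where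
  "EIS f \<longleftrightarrow>
    (\<forall>\<epsilon>>0. \<exists>d>0. \<forall>x g. is_d_method d f g \<longrightarrow>
      (\<exists>y. trajectory g y \<and>
        (\<forall>\<phi>\<in>Lip1.
          limsup (\<lambda>n. ereal ((1 / real n) * (\<Sum>k=1..n. \<phi> ((f ^^ k) x) - \<phi> (y k)))) \<le> ereal \<epsilon>)))"

definition prob_measures :: "'a::metric_space measure set" where
  "prob_measures = {\<mu>. prob_space \<mu> \<and> sets \<mu> = sets borel}"

definition inv_measures :: "('a::metric_space \<Rightarrow> 'a) \<Rightarrow> 'a measure set" where
  "inv_measures f =
    {\<mu> \<in> prob_measures. \<forall>A\<in>sets borel. emeasure \<mu> (f -` A) = emeasure \<mu> A}"

text \<open>
  The coarsest topology on \<open>prob_measures\<close> that makes \<open>\<mu> \<mapsto> \<integral>\<phi> d\<mu>\<close> continuous for every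
  continuous \<open>\<phi>\<close>.
\<close>

definition weak_star :: "'a::metric_space measure topology" where
  "weak_star = topology_generated_by
    {{\<mu> \<in> prob_measures. integral\<^sup>L \<mu> \<phi> \<in> U} |(\<phi> :: 'a \<Rightarrow> real) U. continuous_on UNIV \<phi> \<and> open U}"

lemma topspace_weak_star: "topspace weak_star = prob_measures"
proof -
  have "prob_measures \<in> {{\<mu> \<in> prob_measures. integral\<^sup>L \<mu> \<phi> \<in> U} |(\<phi> :: 'a \<Rightarrow> real) U.
      continuous_on UNIV \<phi> \<and> open U}"
    by (rule CollectI, rule exI[of _ "\<lambda>_. 0"], rule exI[of _ UNIV]) auto
  then show ?thesis
    unfolding weak_star_def topology_generated_by_topspace by blast
qed

definition W1 :: "'a::metric_space measure \<Rightarrow> 'a measure \<Rightarrow> real" where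
  "W1 \<mu> \<nu> = (SUP \<phi>\<in>Lip1. \<bar>integral\<^sup>L \<mu> \<phi> - integral\<^sup>L \<nu> \<phi>\<bar>)"

definition W1_nbhd :: "real \<Rightarrow> 'a::metric_space measure set \<Rightarrow> 'a measure set" where
  "W1_nbhd \<epsilon> A = {\<mu> \<in> prob_measures. \<exists>\<nu>\<in>A. W1 \<mu> \<nu> < \<epsilon>}"

text \<open>Real-valued suprema are only meaningful for bounded sets, as here on a compact space:\<close>

lemma bdd_above_W1:
  fixes \<mu> \<nu> :: "'a::metric_space measure"
  assumes K: "compact (UNIV :: 'a set)"
    and \<mu>: "\<mu> \<in> prob_measures" and \<nu>: "\<nu> \<in> prob_measures"
  shows "bdd_above ((\<lambda>\<phi>. \<bar>integral\<^sup>L \<mu> \<phi> - integral\<^sup>L \<nu> \<phi>\<bar>) ` Lip1)"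
proof (rule bdd_aboveI2)
  fix \<phi> :: "'a \<Rightarrow> real" assume "\<phi> \<in> Lip1"
  then have lip: "1-lipschitz_on UNIV \<phi>" by (simp add: Lip1_def)
  define D where "D = diameter (UNIV :: 'a set)"
  define c where "c = \<phi> undefined"
  have bd: "\<bar>\<phi> x - c\<bar> \<le> D" for x
  proof -
    have "\<bar>\<phi> x - c\<bar> \<le> dist x undefined"
      using lipschitz_onD[OF lip, of x undefined] by (simp add: c_def dist_real_def)
    also have "\<dots> \<le> D"
      unfolding D_def by (rule diameter_bounded_bound[OF compact_imp_bounded[OF K]]) auto
    finally show ?thesis .
  qed
  have meas: "\<phi> \<in> borel_measurable borel"
    by (rule borel_measurable_continuous_onI[OF lipschitz_on_continuous_on[OF lip]])
  have *: "\<bar>integral\<^sup>L \<rho> \<phi> - c\<bar> \<le> D" if "\<rho> \<in> prob_measures" for \<rho> :: "'a measure"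
  proof -
    interpret prob_space \<rho> using that by (simp add: prob_measures_def)
    have m: "\<phi> \<in> borel_measurable \<rho>"
      using that meas measurable_cong_sets by (fastforce simp: prob_measures_def)
    have "norm (\<phi> x) \<le> \<bar>c\<bar> + D" for x
      using bd[of x] by auto
    then have i: "integrable \<rho> \<phi>"
      by (intro integrable_const_bound[of _ "\<bar>c\<bar> + D"] m) auto
    have "integral\<^sup>L \<rho> \<phi> \<le> c + D"
      by (rule integral_le_const[OF i]) (use bd in \<open>auto simp: abs_le_iff algebra_simps\<close>)
    moreover have "c - D \<le> integral\<^sup>L \<rho> \<phi>"
    proof (rule integral_ge_const[OF i], intro AE_I2)
      fix x show "c - D \<le> \<phi> x" using bd[of x] by (simp add: abs_le_iff)
    qed
    ultimately show ?thesis by (simp add: abs_le_iff)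
  qed
  show "\<bar>integral\<^sup>L \<mu> \<phi> - integral\<^sup>L \<nu> \<phi>\<bar> \<le> 2 * D"
    using *[OF \<mu>] *[OF \<nu>] by linarith
qed

text \<open>
  The weighted sum \<open>\<Sum>i\<in>I. w i \<cdot> \<mu> i\<close>, as a Borel measure; types of measures carry no addition.
\<close>

definition mixture :: "'i set \<Rightarrow> ('i \<Rightarrow> real) \<Rightarrow> ('i \<Rightarrow> 'a::metric_space measure) \<Rightarrow> 'a measure" where
  "mixture I w \<mu> = measure_of UNIV (sets borel) (\<lambda>A. \<Sum>i\<in>I. ennreal (w i) * emeasure (\<mu> i) A)"

lemma sets_mixture [simp]: "sets (mixture I w \<mu>) = sets borel"
  unfolding mixture_def
  by (metis sets.sets_measure_of_eq space_borel)

lemma space_mixture [simp]: "space (mixture I w \<mu>) = UNIV"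
  by (simp add: mixture_def)

lemma emeasure_mixture:
  fixes \<mu> :: "'i \<Rightarrow> 'a::metric_space measure"
  assumes "\<And>i. i \<in> I \<Longrightarrow> sets (\<mu> i) = sets borel" and A: "A \<in> sets borel"
  shows "emeasure (mixture I w \<mu>) A = (\<Sum>i\<in>I. ennreal (w i) * emeasure (\<mu> i) A)"
proof (rule emeasure_measure_of[OF mixture_def])
  show "sets borel \<subseteq> Pow UNIV" by simp
  show "A \<in> sets (mixture I w \<mu>)" using A by simp
  show "positive (sets (mixture I w \<mu>)) (\<lambda>A. \<Sum>i\<in>I. ennreal (w i) * emeasure (\<mu> i) A)"
    by (simp add: positive_def)
  show "countably_additive (sets (mixture I w \<mu>)) (\<lambda>A. \<Sum>i\<in>I. ennreal (w i) * emeasure (\<mu> i) A)"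
  proof (rule countably_additiveI)
    fix B :: "nat \<Rightarrow> 'a set"
    assume B: "range B \<subseteq> sets (mixture I w \<mu>)" "disjoint_family B"
    have "(\<Sum>n. \<Sum>i\<in>I. ennreal (w i) * emeasure (\<mu> i) (B n)) =
        (\<Sum>i\<in>I. \<Sum>n. ennreal (w i) * emeasure (\<mu> i) (B n))"
      by (rule suminf_sum) auto
    also have "\<dots> = (\<Sum>i\<in>I. ennreal (w i) * emeasure (\<mu> i) (\<Union>n. B n))"
    proof (rule sum.cong[OF refl])
      fix i assume "i \<in> I"
      then have "(\<Sum>n. emeasure (\<mu> i) (B n)) = emeasure (\<mu> i) (\<Union>n. B n)"
        using B assms(1) by (intro suminf_emeasure) auto
      then show "(\<Sum>n. ennreal (w i) * emeasure (\<mu> i) (B n)) =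
          ennreal (w i) * emeasure (\<mu> i) (\<Union>n. B n)"
        by simp
    qed
    finally show "(\<Sum>n. \<Sum>i\<in>I. ennreal (w i) * emeasure (\<mu> i) (B n)) =
        (\<Sum>i\<in>I. ennreal (w i) * emeasure (\<mu> i) (\<Union>n. B n))" .
  qed
qed

lemma mixture_in_prob_measures:
  assumes "\<And>i. i \<in> I \<Longrightarrow> \<mu> i \<in> prob_measures" "\<And>i. i \<in> I \<Longrightarrow> 0 \<le> w i" "(\<Sum>i\<in>I. w i) = 1"
  shows "mixture I w \<mu> \<in> prob_measures"
proof -
  have one: "emeasure (\<mu> i) UNIV = 1" if "i \<in> I" for i
    using assms(1)[OF that] prob_space.emeasure_space_1[of "\<mu> i"] sets_eq_imp_space_eq[of "\<mu> i" borel]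
    by (simp add: prob_measures_def)
  have "emeasure (mixture I w \<mu>) UNIV = (\<Sum>i\<in>I. ennreal (w i) * emeasure (\<mu> i) UNIV)"
    using assms(1) by (intro emeasure_mixture) (auto simp: prob_measures_def)
  also have "\<dots> = (\<Sum>i\<in>I. ennreal (w i))"
    by (rule sum.cong) (auto simp: one)
  also have "\<dots> = 1"
    using assms by (simp add: sum_ennreal)
  finally show ?thesis
    by (auto simp: prob_measures_def intro!: prob_spaceI)
qed

definition conv_measures :: "'a::metric_space measure set \<Rightarrow> 'a measure set" where
  "conv_measures A = {mixture {..<n} w \<mu> |(n::nat) w \<mu>.
      (\<forall>i<n. 0 \<le> w i \<and> \<mu> i \<in> A) \<and> (\<Sum>i<n. w i) = 1}"

definition empirical :: "(nat \<Rightarrow> 'a::metric_space \<Rightarrow> 'a) \<Rightarrow> 'a \<Rightarrow> nat \<Rightarrow> 'a measure" where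
  "empirical g x N = mixture {..<N} (\<lambda>_. 1 / real N) (\<lambda>k. return borel (comp_upto g k x))"

definition M0_point :: "(nat \<Rightarrow> 'a::metric_space \<Rightarrow> 'a) \<Rightarrow> 'a \<Rightarrow> 'a measure set" where
  "M0_point g x = (\<Inter>n\<in>{1..}. weak_star closure_of {empirical g x N |N. n \<le> N})"

definition M0 :: "(nat \<Rightarrow> 'a::metric_space \<Rightarrow> 'a) \<Rightarrow> 'a measure set" where
  "M0 g = (\<Union>x. M0_point g x)"

definition limit_measures :: "(nat \<Rightarrow> 'a::metric_space \<Rightarrow> 'a) \<Rightarrow> 'a measure set" where
  "limit_measures g = weak_star closure_of (conv_measures (M0 g))"

end

theory Submission
  imports Defs
begin

text \<open>
  Let \<open>\<mu>\<close> be \<open>f\<close>-invariant and \<open>\<phi> \<in> Lip1\<close>. The time averages of \<open>\<phi>\<close> along \<open>f\<close> all have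
  \<open>\<mu>\<close>-integral \<open>\<integral>\<phi> d\<mu>\<close>, so by dominated convergence some orbit has averages that are infinitely
  often almost as large as \<open>\<integral>\<phi> d\<mu>\<close>; no ergodic theorem or ergodic decomposition is needed. EIS
  gives a trajectory of \<open>g\<close> with almost as large averages, and a limit point \<open>\<nu>\<close> of its empirical
  measures has \<open>\<integral>\<phi> d\<mu> - \<integral>\<phi> d\<nu> \<le> c\<close> with \<open>c\<close> small. Here \<open>\<nu>\<close> depends on \<open>\<phi>\<close>; a minimax argument
  over the convex set \<open>Lip1\<close>, which is totally bounded modulo constants, turns this into one
  \<open>\<nu>\<close> in the convex hull that works for all \<open>\<phi>\<close>, that is, \<open>W1 \<mu> \<nu> < \<epsilon>\<close>.
\<close>

subsection \<open>Integration against mixtures\<close>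

lemma measurable_prob_measures:
  assumes "\<mu> \<in> prob_measures" "\<phi> \<in> borel_measurable borel"
  shows "\<phi> \<in> borel_measurable \<mu>"
  using assms by (simp add: prob_measures_def cong: measurable_cong_sets)

lemma integrable_continuous_prob_measures:
  fixes \<phi> :: "'a::metric_space \<Rightarrow> real"
  assumes K: "compact (UNIV :: 'a set)" and \<mu>: "\<mu> \<in> prob_measures" and \<phi>: "continuous_on UNIV \<phi>"
  shows "integrable \<mu> \<phi>"
proof -
  interpret prob_space \<mu> using \<mu> by (simp add: prob_measures_def)
  obtain B where "\<And>x. norm (\<phi> x) \<le> B"
    using compact_imp_bounded[OF compact_continuous_image[OF \<phi> K]] by (auto simp: bounded_iff)
  then show ?thesis
    by (intro integrable_const_bound[of _ B] measurable_prob_measures[OF \<mu>]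
        borel_measurable_continuous_onI[OF \<phi>]) auto
qed

text \<open>Both sides are additive, homogeneous and continuous along increasing sequences in
  \<open>f\<close>, and on indicators they agree by \<open>emeasure_mixture\<close>.\<close>

lemma nn_integral_mixture:
  fixes \<mu> :: "'i \<Rightarrow> 'a::metric_space measure"
  assumes "finite I" and s: "\<And>i. i \<in> I \<Longrightarrow> sets (\<mu> i) = sets borel" and f: "f \<in> borel_measurable borel"
  shows "(\<integral>\<^sup>+x. f x \<partial>mixture I w \<mu>) = (\<Sum>i\<in>I. ennreal (w i) * (\<integral>\<^sup>+x. f x \<partial>\<mu> i))"
proof -
  have meas: "g \<in> borel_measurable (mixture I w \<mu>)" "\<And>i. i \<in> I \<Longrightarrow> g \<in> borel_measurable (\<mu> i)"
    if "g \<in> borel_measurable borel" for g :: "'a \<Rightarrow> ennreal"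
    using that s by (simp_all cong: measurable_cong_sets)
  show ?thesis
    using f
  proof (induction rule: borel_measurable_induct)
    case (cong f g)
    then have "f = g" by auto
    with cong show ?case by simp
  next
    case (set A)
    then show ?case using s emeasure_mixture[of I \<mu> A w] by simp
  next
    case (mult u c)
    show ?case
      using mult by (simp add: nn_integral_cmult meas sum_distrib_left mult.left_commute)
  next
    case (add u v)
    then show ?case
      by (simp add: nn_integral_add meas sum.distrib distrib_left)
  next
    case (seq U)
    have "(\<integral>\<^sup>+x. (SUP n. U n) x \<partial>mixture I w \<mu>) = (SUP n. \<Sum>i\<in>I. ennreal (w i) * (\<integral>\<^sup>+x. U n x \<partial>\<mu> i))"
      using seq by (simp add: nn_integral_monotone_convergence_SUP meas image_comp)
    also have "\<dots> = (\<Sum>i\<in>I. SUP n. ennreal (w i) * (\<integral>\<^sup>+x. U n x \<partial>\<mu> i))"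
      by (intro ennreal_SUP_sum)
        (auto intro!: incseq_SucI mult_left_mono nn_integral_mono simp: le_funD[OF incseq_SucD[OF \<open>incseq U\<close>]])
    also have "\<dots> = (\<Sum>i\<in>I. ennreal (w i) * (\<integral>\<^sup>+x. (SUP n. U n) x \<partial>\<mu> i))"
      using seq by (intro sum.cong refl) (simp add: nn_integral_monotone_convergence_SUP meas SUP_mult_left_ennreal image_comp)
    finally show ?case .
  qed
qed

text \<open>The positive and negative parts of \<phi> reduce this to
  \<open>nn_integral_mixture\<close>. Nonnegative weights matter because \<open>ennreal\<close> cuts
  negative reals off at 0.\<close>

lemma integral_mixture:
  fixes \<phi> :: "'a::metric_space \<Rightarrow> real"
  assumes I: "finite I" and s: "\<And>i. i \<in> I \<Longrightarrow> sets (\<mu> i) = sets borel"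
    and w: "\<And>i. i \<in> I \<Longrightarrow> 0 \<le> w i" and \<phi>: "\<phi> \<in> borel_measurable borel"
    and int: "\<And>i. i \<in> I \<Longrightarrow> integrable (\<mu> i) \<phi>"
  shows "integral\<^sup>L (mixture I w \<mu>) \<phi> = (\<Sum>i\<in>I. w i * integral\<^sup>L (\<mu> i) \<phi>)"
proof -
  have pos: "has_bochner_integral (mixture I w \<mu>) g (\<Sum>i\<in>I. w i * integral\<^sup>L (\<mu> i) g)"
    if g: "g \<in> borel_measurable borel" "\<And>x. 0 \<le> g x" "\<And>i. i \<in> I \<Longrightarrow> integrable (\<mu> i) g"
    for g :: "'a \<Rightarrow> real"
  proof (rule has_bochner_integral_nn_integral)
    show "g \<in> borel_measurable (mixture I w \<mu>)"
      using g by (simp cong: measurable_cong_sets)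
    show "0 \<le> (\<Sum>i\<in>I. w i * integral\<^sup>L (\<mu> i) g)"
      using g w by (intro sum_nonneg mult_nonneg_nonneg) auto
    have "(\<integral>\<^sup>+x. ennreal (g x) \<partial>mixture I w \<mu>) = (\<Sum>i\<in>I. ennreal (w i) * (\<integral>\<^sup>+x. g x \<partial>\<mu> i))"
      using g by (intro nn_integral_mixture I s) auto
    also have "\<dots> = (\<Sum>i\<in>I. ennreal (w i * integral\<^sup>L (\<mu> i) g))"
      using g w by (intro sum.cong refl) (simp add: nn_integral_eq_integral ennreal_mult')
    also have "\<dots> = ennreal (\<Sum>i\<in>I. w i * integral\<^sup>L (\<mu> i) g)"
      using g w by (intro sum_ennreal) auto
    finally show "(\<integral>\<^sup>+x. ennreal (g x) \<partial>mixture I w \<mu>) = ennreal (\<Sum>i\<in>I. w i * integral\<^sup>L (\<mu> i) g)" .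
  qed (use g in auto)
  have "has_bochner_integral (mixture I w \<mu>) (\<lambda>x. max 0 (\<phi> x) - max 0 (- \<phi> x))
      ((\<Sum>i\<in>I. w i * integral\<^sup>L (\<mu> i) (\<lambda>x. max 0 (\<phi> x))) - (\<Sum>i\<in>I. w i * integral\<^sup>L (\<mu> i) (\<lambda>x. max 0 (- \<phi> x))))"
    using \<phi> int by (intro has_bochner_integral_diff pos) auto
  moreover have "(\<lambda>x. max 0 (\<phi> x) - max 0 (- \<phi> x)) = \<phi>"
    by auto
  moreover have "(\<Sum>i\<in>I. w i * integral\<^sup>L (\<mu> i) (\<lambda>x. max 0 (\<phi> x))) - (\<Sum>i\<in>I. w i * integral\<^sup>L (\<mu> i) (\<lambda>x. max 0 (- \<phi> x)))
      = (\<Sum>i\<in>I. w i * integral\<^sup>L (\<mu> i) \<phi>)"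
    unfolding sum_subtractf[symmetric] right_diff_distrib[symmetric]
  proof (intro sum.cong refl arg_cong2[where f = "(*)"])
    fix i assume "i \<in> I"
    then have "integral\<^sup>L (\<mu> i) (\<lambda>x. max 0 (\<phi> x)) - integral\<^sup>L (\<mu> i) (\<lambda>x. max 0 (- \<phi> x))
        = integral\<^sup>L (\<mu> i) (\<lambda>x. max 0 (\<phi> x) - max 0 (- \<phi> x))"
      using int by (intro Bochner_Integration.integral_diff[symmetric]) auto
    also have "(\<lambda>x. max 0 (\<phi> x) - max 0 (- \<phi> x)) = \<phi>" by auto
    finally show "integral\<^sup>L (\<mu> i) (\<lambda>x. max 0 (\<phi> x)) - integral\<^sup>L (\<mu> i) (\<lambda>x. max 0 (- \<phi> x)) = integral\<^sup>L (\<mu> i) \<phi>" .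
  qed
  ultimately show ?thesis
    by (simp add: has_bochner_integral_iff)
qed

subsection \<open>Weak compactness\<close>

text \<open>At the first index \<open>m\<close> where the digits differ, the terms differ by
  \<open>(1/3)^m\<close>, while all later ones together contribute at most half of that. The
  remaining \<open>(1/3)^m / 2\<close> exceeds \<open>(1/3)^Suc m\<close>, which is at least
  \<open>(1/3)^Suc N\<close>.\<close>

lemma ternary_sum_gap:
  fixes \<alpha> \<beta> :: "nat \<Rightarrow> bool"
  assumes "n \<le> N" "\<alpha> n \<noteq> \<beta> n"
  shows "(1/3::real)^Suc N \<le> \<bar>(\<Sum>k. of_bool (\<alpha> k) * (1/3)^k) - (\<Sum>k. of_bool (\<beta> k) * (1/3)^k)\<bar>" (is "?a \<le> \<bar>?A - ?B\<bar>")
proof -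
  define m where "m = (LEAST n. \<alpha> n \<noteq> \<beta> n)"
  have m: "\<alpha> m \<noteq> \<beta> m" "m \<le> n" "\<And>k. k < m \<Longrightarrow> \<alpha> k = \<beta> k"
    using LeastI[of "\<lambda>n. \<alpha> n \<noteq> \<beta> n", OF assms(2)] Least_le[of "\<lambda>n. \<alpha> n \<noteq> \<beta> n", OF assms(2)]
      not_less_Least[of _ "\<lambda>n. \<alpha> n \<noteq> \<beta> n"]
    unfolding m_def by blast+
  define d :: "nat \<Rightarrow> real" where "d k = (of_bool (\<alpha> k) - of_bool (\<beta> k)) * (1/3)^k" for k
  have geo: "summable (\<lambda>k. (1/3::real)^k)"
    by (simp add: summable_geometric)
  have sm: "summable (\<lambda>k. of_bool (\<gamma> k) * (1/3::real)^k)" for \<gamma> :: "nat \<Rightarrow> bool"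
    by (rule summable_comparison_test'[OF geo, of 0]) auto
  have sd: "summable d"
    unfolding d_def left_diff_distrib by (intro summable_diff sm)
  have "?A - ?B = suminf d"
    unfolding d_def left_diff_distrib by (intro suminf_diff sm)
  also have "\<dots> = (\<Sum>k. d (k + Suc m)) + sum d {..<Suc m}"
    by (rule suminf_split_initial_segment[OF sd])
  also have "sum d {..<Suc m} = d m"
    using m(3) by (simp add: d_def)
  finally have eq: "?A - ?B = (\<Sum>k. d (k + Suc m)) + d m" .
  have "norm (\<Sum>k. d (k + Suc m)) \<le> (\<Sum>k. (1/3)^Suc m * (1/3)^k)"
    by (rule norm_suminf_le) (auto simp: d_def power_add geo intro!: summable_mult)
  also have "\<dots> = (1/3)^Suc m * (3/2)"
    by (subst suminf_mult) (auto simp: geo suminf_geometric)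
  finally have "\<bar>\<Sum>k. d (k + Suc m)\<bar> \<le> (1/3)^m / 2" by simp
  moreover have "\<bar>d m\<bar> = (1/3)^m"
    using m(1) by (auto simp: d_def)
  moreover have "?a \<le> (1/3)^m / 3"
    using power_decreasing[of m N "1/3::real"] m(2) assms(1) by simp
  moreover have "(0::real) < (1/3)^m" by simp
  ultimately show ?thesis
    unfolding eq by linarith
qed

text \<open>
  The code of \<open>x\<close> records in its ternary digits which balls of a countable family contain \<open>x\<close>, as in
  the Cantor set. It reduces compactness of \<open>prob_measures\<close> to Helly's theorem on the real line.
\<close>

lemma ex_measurable_coding:
  assumes K: "compact (UNIV :: 'a set)"
  obtains e :: "'a::metric_space \<Rightarrow> real" where
    "e \<in> borel_measurable borel" "bounded (range e)"
    "\<And>\<eta>. 0 < \<eta> \<Longrightarrow> \<exists>\<delta>>0. \<forall>p q. \<bar>e p - e q\<bar> < \<delta> \<longrightarrow> dist p q < \<eta>"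
proof -
  have "\<exists>k. finite k \<and> (\<Union>x\<in>k. ball x (inverse (real (Suc m)))) = (UNIV :: 'a set)" for m
    using seq_compact_imp_totally_bounded[OF compact_imp_seq_compact[OF K], rule_format, of "inverse (real (Suc m))"] by auto
  then obtain k where k: "\<And>m. finite (k m)"
      "\<And>m. (\<Union>x\<in>k m. ball x (inverse (real (Suc m)))) = (UNIV :: 'a set)"
    by metis
  define \<B> where "\<B> = (\<Union>m. (\<lambda>x. ball x (inverse (real (Suc m)))) ` k m)"
  have cB: "countable \<B>"
    unfolding \<B>_def using k(1) by (auto intro: countable_finite)
  have neB: "\<B> \<noteq> {}"
    using k(2)[of 0] unfolding \<B>_def by blast
  define B where "B = from_nat_into \<B>"
  have openB: "open (B n)" for n
    using from_nat_into[OF neB, of n] unfolding B_def \<B>_def by auto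
  define e :: "'a \<Rightarrow> real" where "e x = (\<Sum>n. of_bool (x \<in> B n) * (1/3)^n)" for x
  have geo: "summable (\<lambda>k. (1/3::real)^k)"
    by (simp add: summable_geometric)
  have sm: "summable (\<lambda>n. norm (of_bool (x \<in> B n) * (1/3::real)^n))" for x
    by (rule summable_comparison_test'[OF geo, of 0]) auto
  show ?thesis
  proof
    have "(\<lambda>x. \<Sum>n. indicator (B n) x * (1/3::real)^n) \<in> borel_measurable borel"
      using openB by (intro borel_measurable_suminf) (auto intro!: borel_measurable_times)
    also have "(\<lambda>x. \<Sum>n. indicator (B n) x * (1/3::real)^n) = e"
      by (auto simp: e_def fun_eq_iff indicator_def)
    finally show "e \<in> borel_measurable borel" .
    have "norm (e x) \<le> (\<Sum>n. (1/3)^n)" for x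
      unfolding e_def by (rule norm_suminf_le[OF _ geo]) auto
    then show "bounded (range e)"
      by (auto simp: bounded_iff)
  next
    fix \<eta> :: real assume "0 < \<eta>"
    then obtain m where m: "inverse (real (Suc m)) < \<eta> / 2"
      using reals_Archimedean[of "\<eta> / 2"] by auto
    define idx where "idx x = to_nat_on \<B> (ball x (inverse (real (Suc m))))" for x :: 'a
    have B_idx: "B (idx x) = ball x (inverse (real (Suc m)))" if "x \<in> k m" for x
      unfolding B_def idx_def using that by (intro from_nat_into_to_nat_on cB) (auto simp: \<B>_def)
    \<comment> \<open>\<open>N\<close> bounds the indices of the balls of the \<open>m\<close>-th
      net. By \<open>ternary_sum_gap\<close>, codes closer than \<open>(1/3)^Suc N\<close> agree on
      membership in each of these balls, so both points lie in a common ball of radius below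
      \<eta>/2.\<close>
    define N where "N = Max (idx ` k m)"
    have "dist p q < \<eta>" if less: "\<bar>e p - e q\<bar> < (1/3)^Suc N" for p q
    proof -
      obtain x where x: "x \<in> k m" "p \<in> ball x (inverse (real (Suc m)))"
        using k(2)[of m] by blast
      have "idx x \<le> N"
        unfolding N_def using k(1) x by auto
      then have "(p \<in> B (idx x)) = (q \<in> B (idx x))"
        using ternary_sum_gap[of "idx x" N "\<lambda>n. p \<in> B n" "\<lambda>n. q \<in> B n"] less
        unfolding e_def by fastforce
      then have "dist x p < \<eta> / 2" "dist x q < \<eta> / 2"
        using x m B_idx by auto
      then show ?thesis
        by metric
    qed
    then show "\<exists>\<delta>>0. \<forall>p q. \<bar>e p - e q\<bar> < \<delta> \<longrightarrow> dist p q < \<eta>"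
      by (intro exI[of _ "(1/3)^Suc N"]) auto
  qed
qed

text \<open>\<open>e\<close> need not be continuous, but its inverse is uniformly continuous on
  \<open>range e\<close> and so extends to the closure. The extension is read off the closed graph
  \<open>R\<close>: this is compact and, by the modulus of \<open>e\<close>, single-valued over the
  first coordinate, so \<open>fst\<close> has a continuous inverse on its image, and
  \<open>h\<close> is that inverse followed by \<open>snd\<close>.\<close>

lemma ex_continuous_decoding:
  assumes K: "compact (UNIV :: 'a set)"
  obtains e :: "'a::metric_space \<Rightarrow> real" and C :: "real set" and h :: "real \<Rightarrow> 'a" where
    "e \<in> borel_measurable borel" "compact C" "continuous_on C h" "\<And>x. e x \<in> C" "\<And>x. h (e x) = x"
proof -
  obtain e :: "'a \<Rightarrow> real" where e: "e \<in> borel_measurable borel" "bounded (range e)"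
    "\<And>\<eta>. 0 < \<eta> \<Longrightarrow> \<exists>\<delta>>0. \<forall>p q. \<bar>e p - e q\<bar> < \<delta> \<longrightarrow> dist p q < \<eta>"
    using ex_measurable_coding[OF K] by blast
  define R where "R = closure (range (\<lambda>x. (e x, x)))"
  have "R \<subseteq> closure (range e \<times> UNIV)"
    unfolding R_def by (intro closure_mono) auto
  then have "R \<subseteq> closure (range e) \<times> UNIV"
    by (simp add: closure_Times)
  then have R: "compact R"
    using compact_Int_closed[OF compact_Times[OF _ K], of "closure (range e)" R] e(2)
    by (simp add: R_def inf.absorb2)
  have inj: "p = q" if R_pq: "(t, p) \<in> R" "(t, q) \<in> R" for t p q
  proof (rule ccontr)
    assume "p \<noteq> q"
    \<comment> \<open>A third of the distance, since \<open>p\<close> and \<open>q\<close> will be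
      joined by three steps shorter than \<eta>: \<open>p\<close> to \<open>x\<close>,
      \<open>x\<close> to \<open>y\<close>, \<open>y\<close> to \<open>q\<close>.\<close>
    define \<eta> where "\<eta> = dist p q / 3"
    have "0 < \<eta>" using \<open>p \<noteq> q\<close> by (simp add: \<eta>_def)
    then obtain \<delta> where \<delta>: "\<delta> > 0" "\<And>p q. \<bar>e p - e q\<bar> < \<delta> \<Longrightarrow> dist p q < \<eta>"
      using e(3) by blast
    have approx: "\<exists>x. dist (e x) t < \<delta> / 2 \<and> dist x z < \<eta>" if z: "(t, z) \<in> R" for z
    proof -
      have "0 < min (\<delta> / 2) \<eta>" using \<delta>(1) \<open>0 < \<eta>\<close> by simp
      then obtain y where "y \<in> range (\<lambda>x. (e x, x))" "dist y (t, z) < min (\<delta> / 2) \<eta>"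
        using z unfolding R_def closure_approachable by blast
      then obtain x where "dist (e x, x) (t, z) < min (\<delta> / 2) \<eta>" by blast
      then show ?thesis
        using dist_fst_le[of "(e x, x)" "(t, z)"] dist_snd_le[of "(e x, x)" "(t, z)"]
        by (intro exI[of _ x]) simp
    qed
    obtain x y where x: "dist (e x) t < \<delta> / 2" "dist x p < \<eta>" and y: "dist (e y) t < \<delta> / 2" "dist y q < \<eta>"
      using approx[OF R_pq(1)] approx[OF R_pq(2)] by blast
    have "dist x y < \<eta>"
      using x(1) y(1) unfolding dist_real_def by (intro \<delta>(2)) linarith
    then have "dist p q < 3 * \<eta>"
      using x(2) y(2) by metric
    then show False by (simp add: \<eta>_def)
  qed
  define g where "g = inv_into R fst"
  have "inj_on fst R"
    using inj by (auto simp: inj_on_def)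
  then have g: "g (fst z) = z" if "z \<in> R" for z
    using that by (simp add: g_def)
  have mem: "(e x, x) \<in> R" for x
    unfolding R_def using closure_subset by fastforce
  show ?thesis
  proof
    show "e \<in> borel_measurable borel" by fact
    show "compact (fst ` R)"
      using R by (intro compact_continuous_image continuous_intros)
    have "continuous_on (fst ` R) g"
      using R g by (intro continuous_on_inv continuous_intros) auto
    then show "continuous_on (fst ` R) (snd \<circ> g)"
      by (intro continuous_on_compose continuous_intros)
    show "e x \<in> fst ` R" for x
      using mem[of x] by force
    show "(snd \<circ> g) (e x) = x" for x
      using g[OF mem[of x]] by simp
  qed
qed

text \<open>The images under \<open>e\<close> are measures on the line carried by one bounded set,
  hence tight, and Helly's selection theorem gives a weakly convergent subsequence. Its limit
  \<open>M\<close> is concentrated on \<open>C\<close>, so \<open>h\<close> carries it back to the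
  space; \<open>h (e x) = x\<close> turns integrals of \<phi> into integrals of \<phi> composed with
  \<open>h\<close>.\<close>

lemma weak_conv_subseq:
  fixes \<mu> :: "nat \<Rightarrow> 'a::metric_space measure"
  assumes K: "compact (UNIV :: 'a set)" and \<mu>: "\<And>n. \<mu> n \<in> prob_measures"
  obtains r \<nu> where "strict_mono (r :: nat \<Rightarrow> nat)" "\<nu> \<in> prob_measures"
    "\<And>\<phi>. continuous_on UNIV (\<phi> :: 'a \<Rightarrow> real) \<Longrightarrow> (\<lambda>j. integral\<^sup>L (\<mu> (r j)) \<phi>) \<longlonglongrightarrow> integral\<^sup>L \<nu> \<phi>"
proof -
  obtain e :: "'a \<Rightarrow> real" and C h where e: "e \<in> borel_measurable borel"
    and C: "compact C" and h: "continuous_on C h" and eC: "\<And>x. e x \<in> C" and he: "\<And>x. h (e x) = x"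
    using ex_continuous_decoding[OF K] by blast
  have e\<mu>: "e \<in> borel_measurable (\<mu> n)" for n
    by (rule measurable_prob_measures[OF \<mu> e])
  define L where "L n = distr (\<mu> n) borel e" for n
  have L: "real_distribution (L n)" for n
    using \<mu>[of n] prob_space.real_distribution_distr[OF _ e\<mu>] by (simp add: L_def prob_measures_def)
  obtain B where B: "\<And>t. t \<in> C \<Longrightarrow> \<bar>t\<bar> \<le> B"
    using compact_imp_bounded[OF C] by (auto simp: bounded_iff)
  have "tight L"
    unfolding tight_def
  proof (intro conjI allI impI)
    fix \<epsilon> :: real assume "0 < \<epsilon>"
    have "measure (L n) {- (\<bar>B\<bar> + 1)<..\<bar>B\<bar> + 1} > 1 - \<epsilon>" for n
    proof -
      interpret prob_space "\<mu> n" using \<mu>[of n] by (simp add: prob_measures_def)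
      have "- (\<bar>B\<bar> + 1) < e x \<and> e x \<le> \<bar>B\<bar> + 1" for x
        using B[OF eC[of x]] by linarith
      then have "e -` {- (\<bar>B\<bar> + 1)<..\<bar>B\<bar> + 1} = UNIV"
        by auto
      moreover have "space (\<mu> n) = UNIV"
        using \<mu>[of n] by (auto simp: prob_measures_def dest: sets_eq_imp_space_eq)
      ultimately have "measure (L n) {- (\<bar>B\<bar> + 1)<..\<bar>B\<bar> + 1} = 1"
        unfolding L_def using prob_space by (simp add: measure_distr[OF e\<mu>])
      then show ?thesis using \<open>0 < \<epsilon>\<close> by simp
    qed
    then show "\<exists>a b. a < b \<and> (\<forall>n. 1 - \<epsilon> < measure (L n) {a<..b})"
      by (intro exI[of _ "- (\<bar>B\<bar> + 1)"] exI[of _ "\<bar>B\<bar> + 1"]) auto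
  qed (rule L)
  then obtain r M where r: "strict_mono r" and M: "real_distribution M" and wc: "weak_conv_m (L \<circ> r) M"
    using tight_imp_convergent_subsubsequence[of L id] by (auto simp: strict_mono_id)
  interpret M: real_distribution M by fact
  have conv: "(\<lambda>j. integral\<^sup>L (\<mu> (r j)) (\<lambda>x. \<psi> (e x))) \<longlonglongrightarrow> integral\<^sup>L M \<psi>"
    if \<psi>: "continuous_on UNIV \<psi>" "\<And>t. \<bar>\<psi> t\<bar> \<le> b" for \<psi> :: "real \<Rightarrow> real" and b
  proof -
    have "(\<lambda>j. integral\<^sup>L ((L \<circ> r) j) \<psi>) \<longlonglongrightarrow> integral\<^sup>L M \<psi>"
      by (rule weak_conv_imp_integral_bdd_continuous_conv[OF _ M wc, where B = b])
        (use L \<psi> in \<open>auto simp: continuous_on_eq_continuous_at\<close>)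
    moreover have "integral\<^sup>L ((L \<circ> r) j) \<psi> = integral\<^sup>L (\<mu> (r j)) (\<lambda>x. \<psi> (e x))" for j
      unfolding L_def comp_def
      by (rule integral_distr[OF e\<mu>]) (rule borel_measurable_continuous_onI[OF \<psi>(1)])
    ultimately show ?thesis by simp
  qed
  have "C \<noteq> {}" using eC by auto
  have "closed C" by (rule compact_imp_closed[OF C])
  have AE: "AE t in M. t \<in> C"
  proof -
    \<comment> \<open>A bounded continuous function that vanishes exactly on the closed set
      \<open>C\<close>. Its integrals along the sequence are 0, hence so is the one over
      \<open>M\<close>.\<close>
    define \<psi> where "\<psi> t = min 1 (infdist t C)" for t
    have c\<psi>: "continuous_on UNIV \<psi>"
      unfolding \<psi>_def by (intro continuous_intros)
    have "(\<lambda>j. integral\<^sup>L (\<mu> (r j)) (\<lambda>x. \<psi> (e x))) \<longlonglongrightarrow> integral\<^sup>L M \<psi>"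
      by (rule conv[OF c\<psi>, of 1]) (auto simp: \<psi>_def infdist_nonneg)
    moreover have "\<psi> (e x) = 0" for x
      using eC by (simp add: \<psi>_def)
    ultimately have "integral\<^sup>L M \<psi> = 0"
      using LIMSEQ_unique[OF tendsto_const[of 0 sequentially]] by simp
    moreover have "integrable M \<psi>"
      using borel_measurable_continuous_onI[OF c\<psi>]
      by (intro M.integrable_const_bound[of _ 1]) (auto simp: \<psi>_def infdist_nonneg)
    ultimately have "AE t in M. \<psi> t = 0"
      by (subst integral_nonneg_eq_0_iff_AE[symmetric]) (auto simp: \<psi>_def infdist_nonneg)
    then show ?thesis
    proof (rule AE_mp, intro AE_I2 impI)
      fix t assume "\<psi> t = 0"
      then show "t \<in> C"
        using in_closed_iff_infdist_zero[OF \<open>closed C\<close> \<open>C \<noteq> {}\<close>] by (simp add: \<psi>_def min_def split: if_splits)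
    qed
  qed
  \<comment> \<open>\<open>M\<close> gives no mass to the complement of \<open>C\<close>, so the
    value there is arbitrary; it only makes \<open>H\<close> a Borel function on the whole
    line.\<close>
  define H where "H t = (if t \<in> C then h t else h (e undefined))" for t
  have H: "H \<in> borel_measurable borel"
    unfolding H_def
    by (rule measurable_If_restrict_space_iff[THEN iffD2])
      (use \<open>closed C\<close> in \<open>auto intro!: borel_measurable_continuous_on_restrict h\<close>)
  have HM: "H \<in> borel_measurable M"
    using H by simp
  define \<nu> where "\<nu> = distr M borel H"
  show ?thesis
  proof
    show "strict_mono r" by fact
    show "\<nu> \<in> prob_measures"
      unfolding \<nu>_def prob_measures_def using M.prob_space_distr[OF HM] by simp
    fix \<phi> :: "'a \<Rightarrow> real" assume \<phi>: "continuous_on UNIV \<phi>"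
    obtain b where b: "\<And>x. \<bar>\<phi> x\<bar> \<le> b"
      using compact_imp_bounded[OF compact_continuous_image[OF \<phi> K]] by (auto simp: bounded_iff)
    have "continuous_on C (\<lambda>t. \<phi> (h t))"
      by (rule continuous_on_compose2[OF \<phi> h]) auto
    moreover have "0 \<le> b" using b[of undefined] by linarith
    \<comment> \<open>\<phi> composed with \<open>h\<close> lives on \<open>C\<close> only. Tietze
      extends it to the line with the same bound, as \<open>conv\<close> requires.\<close>
    ultimately obtain \<psi> where \<psi>: "continuous_on UNIV \<psi>" "\<And>t. t \<in> C \<Longrightarrow> \<psi> t = \<phi> (h t)" "\<And>t. \<bar>\<psi> t\<bar> \<le> b"
      using Tietze[of C "\<lambda>t. \<phi> (h t)" UNIV b] \<open>closed C\<close> b by (auto simp: closed_closedin[symmetric])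
    have "integral\<^sup>L \<nu> \<phi> = integral\<^sup>L M (\<lambda>t. \<phi> (H t))"
      unfolding \<nu>_def by (rule integral_distr[OF HM]) (rule borel_measurable_continuous_onI[OF \<phi>])
    also have "\<dots> = integral\<^sup>L M \<psi>"
    proof (rule integral_cong_AE)
      show "(\<lambda>t. \<phi> (H t)) \<in> borel_measurable M"
        using measurable_compose[OF HM borel_measurable_continuous_onI[OF \<phi>]] .
      show "\<psi> \<in> borel_measurable M"
        using borel_measurable_continuous_onI[OF \<psi>(1)] by simp
      show "AE t in M. \<phi> (H t) = \<psi> t"
        using AE by (rule AE_mp) (auto simp: H_def \<psi>(2))
    qed
    finally show "(\<lambda>j. integral\<^sup>L (\<mu> (r j)) \<phi>) \<longlonglongrightarrow> integral\<^sup>L \<nu> \<phi>"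
      using conv[OF \<psi>(1,3)] by (simp add: \<psi>(2) eC he)
  qed
qed

text \<open>Convergence of all integrals of continuous functions is convergence in
  \<open>weak_star\<close>: induction on how \<open>T\<close> is generated reduces to subbasic sets,
  where it is the hypothesis on integrals. The premise on \<open>prob_measures\<close> enters there
  because subbasic sets consist of probability measures.\<close>

lemma eventually_in_weak_star_open:
  fixes \<nu> :: "'a::metric_space measure"
  assumes T: "openin weak_star T" "\<nu> \<in> T" and \<mu>: "\<forall>\<^sub>F j in F. \<mu> j \<in> prob_measures"
    and conv: "\<And>\<phi> :: 'a \<Rightarrow> real. continuous_on UNIV \<phi> \<Longrightarrow> ((\<lambda>j. integral\<^sup>L (\<mu> j) \<phi>) \<longlongrightarrow> integral\<^sup>L \<nu> \<phi>) F"
  shows "\<forall>\<^sub>F j in F. \<mu> j \<in> T"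
proof -
  have "generate_topology_on {{\<mu> \<in> prob_measures. integral\<^sup>L \<mu> \<phi> \<in> U} |(\<phi> :: 'a \<Rightarrow> real) U. continuous_on UNIV \<phi> \<and> open U} T"
    using T(1) unfolding weak_star_def openin_topology_generated_by_iff .
  then show ?thesis
    using T(2)
  proof induction
    case Empty
    then show ?case by simp
  next
    case (Int a b)
    then show ?case by (simp add: eventually_conj)
  next
    case (UN \<K>)
    then obtain k where "k \<in> \<K>" "\<nu> \<in> k" by blast
    with UN.IH have "\<forall>\<^sub>F j in F. \<mu> j \<in> k" by blast
    then show ?case
      by (rule eventually_mono) (use \<open>k \<in> \<K>\<close> in blast)
  next
    case (Basis s)
    from Basis(1) obtain \<phi> :: "'a \<Rightarrow> real" and U
      where s: "s = {\<mu> \<in> prob_measures. integral\<^sup>L \<mu> \<phi> \<in> U}" "continuous_on UNIV \<phi>" "open U"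
      by blast
    then have "\<forall>\<^sub>F j in F. integral\<^sup>L (\<mu> j) \<phi> \<in> U"
      using topological_tendstoD[OF conv[OF s(2)] s(3)] Basis(2) by simp
    with \<mu> show ?case
      unfolding s(1) by eventually_elim simp
  qed
qed

section \<open>Empirical measures and their limit points\<close>

lemma empirical_in_prob_measures: "1 \<le> N \<Longrightarrow> empirical g x N \<in> prob_measures"
  unfolding empirical_def
  by (rule mixture_in_prob_measures) (auto simp: prob_measures_def prob_space_return)

lemma integral_empirical:
  fixes \<phi> :: "'a::metric_space \<Rightarrow> real"
  assumes K: "compact (UNIV :: 'a set)" and \<phi>: "continuous_on UNIV \<phi>"
  shows "integral\<^sup>L (empirical g x N) \<phi> = (1 / real N) * (\<Sum>k<N. \<phi> (comp_upto g k x))"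
proof -
  have "\<phi> \<in> borel_measurable borel" by (rule borel_measurable_continuous_onI[OF \<phi>])
  moreover have "return borel y \<in> prob_measures" for y :: 'a
    by (simp add: prob_measures_def prob_space_return)
  ultimately show ?thesis
    unfolding empirical_def
    by (subst integral_mixture)
      (auto simp: integrable_continuous_prob_measures[OF K _ \<phi>] integral_return sum_distrib_left)
qed

lemma limit_of_empirical_in_M0_point:
  fixes \<nu> :: "'a::metric_space measure"
  assumes s: "strict_mono s" and \<nu>: "\<nu> \<in> prob_measures"
    and conv: "\<And>\<phi> :: 'a \<Rightarrow> real. continuous_on UNIV \<phi> \<Longrightarrow> (\<lambda>j. integral\<^sup>L (empirical g x (s j)) \<phi>) \<longlonglongrightarrow> integral\<^sup>L \<nu> \<phi>"
  shows "\<nu> \<in> M0_point g x"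
proof -
  have large: "\<forall>\<^sub>F j in sequentially. n \<le> s j" for n
    using filterlim_subseq[OF s] by (simp add: filterlim_at_top)
  have "\<nu> \<in> weak_star closure_of {empirical g x N |N. n \<le> N}" for n
    unfolding in_closure_of topspace_weak_star
  proof (intro conjI allI impI, rule \<nu>)
    fix T assume T: "\<nu> \<in> T \<and> openin weak_star T"
    \<comment> \<open>\<open>empirical g x 0\<close> is the zero measure and \<open>s 0\<close> may
      be 0, so this holds only eventually.\<close>
    have "\<forall>\<^sub>F j in sequentially. empirical g x (s j) \<in> prob_measures"
      using large[of 1] by (rule eventually_mono) (rule empirical_in_prob_measures)
    with T conv have "\<forall>\<^sub>F j in sequentially. empirical g x (s j) \<in> T"
      by (intro eventually_in_weak_star_open[of T \<nu>]) auto
    with large[of n] have "\<forall>\<^sub>F j in sequentially. empirical g x (s j) \<in> T \<and> n \<le> s j"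
      by eventually_elim simp
    then obtain j where "empirical g x (s j) \<in> T" "n \<le> s j"
      using eventually_happens'[OF sequentially_bot] by blast
    then show "\<exists>y. y \<in> {empirical g x N |N. n \<le> N} \<and> y \<in> T" by blast
  qed
  then show ?thesis by (simp add: M0_point_def)
qed

subsection \<open>A minimax principle for the Wasserstein distance\<close>

text \<open>A quadratic upper bound for the square of the positive part, whose derivative at
  \<open>x\<close> is \<open>2 * max 0 x\<close>. It controls the change of the potential below
  along a small step.\<close>

lemma square_pos_part_add_le: "(max 0 (x + h))\<^sup>2 \<le> (max 0 x)\<^sup>2 + 2 * max 0 x * h + h\<^sup>2" for x h :: real
proof (cases "0 \<le> x")
  case True
  have "(max 0 (x + h))\<^sup>2 \<le> (x + h)\<^sup>2" by (simp add: max_def)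
  then show ?thesis using True by (simp add: power2_sum algebra_simps)
next
  case False
  then have "max 0 (x + h) \<le> \<bar>h\<bar>" by simp
  then have "(max 0 (x + h))\<^sup>2 \<le> \<bar>h\<bar>\<^sup>2" by (intro power_mono) auto
  then show ?thesis using False by simp
qed

text \<open>
  The potential \<open>\<Phi> v = \<Sum>\<^sub>i ((v\<^sub>i - c)\<^sup>+)\<^sup>2\<close> cannot have a positive infimum: moving from \<open>v\<close> by a
  small \<open>t\<close> towards a \<open>u\<close> that is good for the weights \<open>(v\<^sub>i - c)\<^sup>+\<close> multiplies it by \<open>1 - 2 t\<close>
  up to an error of order \<open>t\<^sup>2\<close>. This replaces a separation theorem.
\<close>

lemma approximate_minimax:
  fixes S V :: "('i \<Rightarrow> real) set" and B :: "'i \<Rightarrow> real"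
  assumes I: "finite I" and S: "S \<noteq> {}"
    and step: "\<And>v u t. v \<in> S \<Longrightarrow> u \<in> V \<Longrightarrow> 0 \<le> t \<Longrightarrow> t \<le> 1 \<Longrightarrow>
      \<exists>v'\<in>S. \<forall>i\<in>I. v' i = (1 - t) * v i + t * u i"
    and bound: "\<And>v i. v \<in> S \<union> V \<Longrightarrow> i \<in> I \<Longrightarrow> \<bar>v i\<bar> \<le> B i"
    and weights: "\<And>a. (\<And>i. i \<in> I \<Longrightarrow> 0 \<le> a i) \<Longrightarrow> (\<Sum>i\<in>I. a i) = 1 \<Longrightarrow> \<exists>u\<in>V. (\<Sum>i\<in>I. a i * u i) \<le> c"
    and \<eta>: "0 < \<eta>"
  shows "\<exists>v\<in>S. \<forall>i\<in>I. v i \<le> c + \<eta>"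
proof (rule ccontr)
  assume contra: "\<not> ?thesis"
  define \<Phi> where "\<Phi> v = (\<Sum>i\<in>I. (max 0 (v i - c))\<^sup>2)" for v :: "'i \<Rightarrow> real"
  define D where "D = (\<Sum>i\<in>I. (2 * B i)\<^sup>2)"
  define \<delta> where "\<delta> = (INF v\<in>S. \<Phi> v)"
  \<comment> \<open>If the claim fails, every point of \<open>S\<close> has a coordinate above
    \<open>c + \<eta>\<close>, which keeps the infimum \<delta> at least
    \<open>\<eta>\<^sup>2\<close>.\<close>
  have \<Phi>: "\<eta>\<^sup>2 \<le> \<Phi> v" if "v \<in> S" for v
  proof -
    obtain i where i: "i \<in> I" "c + \<eta> < v i"
      using contra \<open>v \<in> S\<close> by (auto simp: not_le)
    have "\<eta>\<^sup>2 \<le> (max 0 (v i - c))\<^sup>2"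
      using i \<eta> by (intro power_mono) auto
    also have "\<dots> \<le> \<Phi> v"
      unfolding \<Phi>_def using I i by (intro member_le_sum) auto
    finally show ?thesis .
  qed
  have bdd: "bdd_below (\<Phi> ` S)"
    using \<Phi> by (rule bdd_belowI2)
  have "\<eta>\<^sup>2 \<le> \<delta>"
    unfolding \<delta>_def using \<Phi> by (intro cINF_greatest S)
  then have "0 < \<delta>"
    using \<eta> by (meson less_le_trans zero_less_power)
  have "0 \<le> D" unfolding D_def by (intro sum_nonneg) simp
  have descent: "\<delta> \<le> (1 - 2 * t) * \<Phi> v + t\<^sup>2 * D" if v: "v \<in> S" and t: "0 \<le> t" "t \<le> 1" for v t
  proof -
    \<comment> \<open>Half the gradient of the potential at \<open>v\<close>. Divided by its sum
      \<open>A\<close> it becomes the weight vector for which \<open>weights\<close> returns the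
      target \<open>u\<close> of the descent.\<close>
    define m where "m i = max 0 (v i - c)" for i
    define A where "A = sum m I"
    have m: "0 \<le> m i" for i by (simp add: m_def)
    have "A \<noteq> 0"
    proof
      assume "A = 0"
      then have "\<Phi> v = 0"
        using I m unfolding A_def \<Phi>_def by (auto simp: sum_nonneg_eq_0_iff m_def)
      then show False using \<Phi>[OF v] zero_less_power[OF \<eta>, of 2] by simp
    qed
    then have "0 < A" using m by (simp add: A_def sum_nonneg less_le)
    then obtain u where u: "u \<in> V" "(\<Sum>i\<in>I. m i / A * u i) \<le> c"
      using weights[of "\<lambda>i. m i / A"] m \<open>A \<noteq> 0\<close> by (auto simp: sum_divide_distrib[symmetric] A_def[symmetric])
    have "(\<Sum>i\<in>I. m i * u i) = A * (\<Sum>i\<in>I. m i / A * u i)"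
      using \<open>A \<noteq> 0\<close> by (simp add: sum_distrib_left)
    also have "\<dots> \<le> A * c"
      using u(2) \<open>0 < A\<close> by simp
    finally have mu: "(\<Sum>i\<in>I. m i * u i) \<le> A * c" .
    \<comment> \<open>On each coordinate \<open>m i * v i = m i * c + (m i)\<^sup>2\<close>, as
      \<open>m i\<close> vanishes unless \<open>v i > c\<close>.\<close>
    have "(\<Sum>i\<in>I. m i * (u i - v i)) = (\<Sum>i\<in>I. m i * u i - m i * c - (m i)\<^sup>2)"
      by (intro sum.cong refl) (auto simp: m_def max_def power2_eq_square algebra_simps)
    also have "\<dots> = (\<Sum>i\<in>I. m i * u i) - A * c - \<Phi> v"
      by (simp add: sum_subtractf A_def \<Phi>_def m_def sum_distrib_right)
    finally have dir: "(\<Sum>i\<in>I. m i * (u i - v i)) \<le> - \<Phi> v"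
      using mu by simp
    obtain v' where v': "v' \<in> S" "\<And>i. i \<in> I \<Longrightarrow> v' i = (1 - t) * v i + t * u i"
      using step[OF v u(1) t] by blast
    have "\<delta> \<le> \<Phi> v'"
      unfolding \<delta>_def by (rule cINF_lower[OF bdd v'(1)])
    also have "\<dots> \<le> (\<Sum>i\<in>I. (m i)\<^sup>2 + 2 * t * (m i * (u i - v i)) + t\<^sup>2 * (2 * B i)\<^sup>2)"
      unfolding \<Phi>_def
    proof (rule sum_mono)
      fix i assume i: "i \<in> I"
      have "\<bar>u i - v i\<bar> \<le> 2 * B i"
        using bound[of u i] bound[of v i] u(1) v i by fastforce
      then have "(u i - v i)\<^sup>2 \<le> (2 * B i)\<^sup>2"
        using power_mono[of "\<bar>u i - v i\<bar>" "2 * B i" 2] by simp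
      then have "(t * (u i - v i))\<^sup>2 \<le> t\<^sup>2 * (2 * B i)\<^sup>2"
        unfolding power_mult_distrib by (intro mult_left_mono) auto
      moreover have "v' i - c = (v i - c) + t * (u i - v i)"
        using v'(2)[OF i] by (simp add: algebra_simps)
      moreover have "2 * m i * (t * (u i - v i)) = 2 * t * (m i * (u i - v i))"
        by simp
      ultimately show "(max 0 (v' i - c))\<^sup>2 \<le> (m i)\<^sup>2 + 2 * t * (m i * (u i - v i)) + t\<^sup>2 * (2 * B i)\<^sup>2"
        using square_pos_part_add_le[of "v i - c" "t * (u i - v i)"] unfolding m_def[symmetric]
        by (metis add_left_mono order_trans)
    qed
    also have "\<dots> = \<Phi> v + 2 * t * (\<Sum>i\<in>I. m i * (u i - v i)) + t\<^sup>2 * D"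
      by (simp add: sum.distrib sum_distrib_left \<Phi>_def m_def D_def)
    also have "\<dots> \<le> \<Phi> v + 2 * t * (- \<Phi> v) + t\<^sup>2 * D"
      using dir t(1) by (intro add_mono mult_left_mono order_refl) auto
    finally show ?thesis by (simp add: algebra_simps)
  qed
  \<comment> \<open>The bound 1/2 keeps \<open>1 - 2 * t\<close> nonnegative, and the other one
    makes the error \<open>t\<^sup>2 * D\<close> at most \<open>t * \<delta>\<close>;
    \<open>D + 1\<close> is a positive denominator. From a point with potential below
    \<open>\<delta> + t * \<delta>\<close> the descent then reaches at most
    \<open>\<delta> - 2 * t\<^sup>2 * \<delta>\<close>, below the infimum.\<close>
  define t where "t = min (1/2) (\<delta> / (D + 1))"
  have t: "0 < t" "t \<le> 1/2"
    unfolding t_def using \<open>0 < \<delta>\<close> \<open>0 \<le> D\<close> by (simp, intro min.cobounded1)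
  have "t \<le> \<delta> / (D + 1)" by (simp add: t_def)
  then have "t * (D + 1) \<le> \<delta>"
    using \<open>0 \<le> D\<close> by (simp add: pos_le_divide_eq)
  then have "t * D \<le> \<delta>"
    using t by (simp add: algebra_simps)
  then have "t * (t * D) \<le> t * \<delta>"
    using t by (intro mult_left_mono) auto
  then have tD: "t\<^sup>2 * D \<le> t * \<delta>"
    by (simp add: power2_eq_square mult_ac)
  have "\<delta> < \<delta> + t * \<delta>" using t \<open>0 < \<delta>\<close> by simp
  then obtain v where v: "v \<in> S" "\<Phi> v < \<delta> + t * \<delta>"
    using cInf_lessD[of "\<Phi> ` S" "\<delta> + t * \<delta>"] S unfolding \<delta>_def by blast
  have "\<delta> \<le> (1 - 2 * t) * \<Phi> v + t\<^sup>2 * D"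
    using descent[OF v(1), of t] t by simp
  also have "\<dots> \<le> (1 - 2 * t) * (\<delta> + t * \<delta>) + t * \<delta>"
    using v(2) t tD by (intro add_mono mult_left_mono) auto
  also have "\<dots> = \<delta> - 2 * (t * (t * \<delta>))"
    by (simp add: algebra_simps)
  also have "\<dots> < \<delta>"
    using t \<open>0 < \<delta>\<close> by simp
  finally show False by simp
qed

section \<open>Finite nets of Lipschitz functions modulo constants\<close>

text \<open>Rounding \<open>(\<phi> p - \<phi> z) / \<delta>\<close> down at the finitely many
  centres \<open>p\<close> leaves finitely many patterns \<open>Q \<phi>\<close>, since these
  differences are bounded by \<open>D\<close>; one function is kept per pattern. Two functions with
  the same pattern differ, after subtraction of their values at \<open>z\<close>, by less than
  \<delta> at the centres, hence by less than \<open>3 * \<delta> = \<eta>\<close>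
  everywhere.\<close>

lemma Lip1_finite_net:
  assumes K: "compact (UNIV :: 'a set)" and \<eta>: "0 < \<eta>"
  obtains P :: "('a::metric_space \<Rightarrow> real) set" where "finite P" "P \<subseteq> Lip1"
    "\<And>\<phi>. \<phi> \<in> Lip1 \<Longrightarrow> \<exists>\<psi>\<in>P. \<exists>c. \<forall>x. \<bar>\<phi> x - \<psi> x - c\<bar> \<le> \<eta>"
proof -
  define \<delta> where "\<delta> = \<eta> / 3"
  have "0 < \<delta>" using \<eta> by (simp add: \<delta>_def)
  then obtain k :: "'a set" where k: "finite k" "UNIV = (\<Union>x\<in>k. ball x \<delta>)"
    using seq_compact_imp_totally_bounded[OF compact_imp_seq_compact[OF K], rule_format, of \<delta>] by auto
  define z :: 'a where "z = undefined"
  obtain D where D: "\<And>x. dist z x \<le> D"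
    using compact_imp_bounded[OF K] by (auto simp: bounded_any_center[of _ z])
  have lip: "\<bar>\<phi> x - \<phi> y\<bar> \<le> dist x y" if "\<phi> \<in> Lip1" for \<phi> and x y :: 'a
    using that lipschitz_onD[of 1 UNIV \<phi> x y] by (simp add: Lip1_def dist_real_def)
  define Q where "Q \<phi> = restrict (\<lambda>p. \<lfloor>(\<phi> p - \<phi> z) / \<delta>\<rfloor>) k" for \<phi> :: "'a \<Rightarrow> real"
  have "Q ` Lip1 \<subseteq> k \<rightarrow>\<^sub>E {\<lfloor>- D / \<delta>\<rfloor>..\<lfloor>D / \<delta>\<rfloor>}"
  proof (intro image_subsetI)
    fix \<phi> :: "'a \<Rightarrow> real" assume \<phi>: "\<phi> \<in> Lip1"
    have "- D \<le> \<phi> p - \<phi> z" "\<phi> p - \<phi> z \<le> D" for p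
      using lip[OF \<phi>, of z p] D[of p] by linarith+
    then have "- D / \<delta> \<le> (\<phi> p - \<phi> z) / \<delta>" "(\<phi> p - \<phi> z) / \<delta> \<le> D / \<delta>" for p
      using \<open>0 < \<delta>\<close> by (intro divide_right_mono; simp)+
    then show "Q \<phi> \<in> k \<rightarrow>\<^sub>E {\<lfloor>- D / \<delta>\<rfloor>..\<lfloor>D / \<delta>\<rfloor>}"
      unfolding Q_def restrict_PiE_iff by (auto simp del: minus_divide_left intro!: floor_mono)
  qed
  then have fin: "finite (Q ` Lip1)"
    by (rule finite_subset) (intro finite_PiE k(1) finite_atLeastAtMost_int)
  show ?thesis
  proof
    show "finite (inv_into Lip1 Q ` (Q ` Lip1))" using fin by simp
    show "inv_into Lip1 Q ` (Q ` Lip1) \<subseteq> Lip1" by (auto intro: inv_into_into)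
    fix \<phi> :: "'a \<Rightarrow> real" assume \<phi>: "\<phi> \<in> Lip1"
    define \<psi> where "\<psi> = inv_into Lip1 Q (Q \<phi>)"
    have \<psi>: "\<psi> \<in> Lip1" "Q \<psi> = Q \<phi>"
      using \<phi> by (auto simp: \<psi>_def inv_into_into f_inv_into_f)
    have "\<bar>\<phi> x - \<psi> x - (\<phi> z - \<psi> z)\<bar> \<le> \<eta>" for x
    proof -
      obtain p where p: "p \<in> k" "dist p x < \<delta>"
        using k(2) by (metis UNIV_I UN_iff mem_ball)
      have "\<lfloor>(\<phi> p - \<phi> z) / \<delta>\<rfloor> = \<lfloor>(\<psi> p - \<psi> z) / \<delta>\<rfloor>"
        using fun_cong[OF \<psi>(2), of p] p(1) by (simp add: Q_def)
      then have "\<bar>(\<phi> p - \<phi> z) / \<delta> - (\<psi> p - \<psi> z) / \<delta>\<bar> < 1"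
        by linarith
      then have "\<bar>(\<phi> p - \<phi> z) - (\<psi> p - \<psi> z)\<bar> < \<delta>"
        unfolding diff_divide_distrib[symmetric] abs_divide using \<open>0 < \<delta>\<close> by simp
      then show ?thesis
        using lip[OF \<phi>, of p x] lip[OF \<psi>(1), of p x] p(2) unfolding \<delta>_def by linarith
    qed
    then show "\<exists>\<psi>\<in>inv_into Lip1 Q ` (Q ` Lip1). \<exists>c. \<forall>x. \<bar>\<phi> x - \<psi> x - c\<bar> \<le> \<eta>"
      using \<phi> unfolding \<psi>_def by blast
  qed
qed

lemma continuous_on_Lip1: "\<phi> \<in> Lip1 \<Longrightarrow> continuous_on UNIV \<phi>"
  by (auto simp: Lip1_def intro: lipschitz_on_continuous_on)

lemma uminus_in_Lip1: "\<phi> \<in> Lip1 \<Longrightarrow> (\<lambda>x. - \<phi> x) \<in> Lip1"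
  by (auto simp: Lip1_def intro: lipschitz_on_minus)

text \<open>Weights on finitely many test functions thus produce one test function, which lets the
  weights in \<open>approximate_minimax\<close> meet a hypothesis about single elements of
  \<open>Lip1\<close>.\<close>

lemma convex_combination_in_Lip1:
  assumes "\<And>i. i \<in> I \<Longrightarrow> \<phi> i \<in> Lip1" "\<And>i. i \<in> I \<Longrightarrow> 0 \<le> a i" "(\<Sum>i\<in>I. a i) = 1"
  shows "(\<lambda>x. \<Sum>i\<in>I. a i * \<phi> i x) \<in> Lip1"
  unfolding Lip1_def
proof (intro CollectI lipschitz_onI)
  fix x y
  have "dist (\<Sum>i\<in>I. a i * \<phi> i x) (\<Sum>i\<in>I. a i * \<phi> i y) = \<bar>\<Sum>i\<in>I. a i * (\<phi> i x - \<phi> i y)\<bar>"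
    by (simp add: dist_real_def sum_subtractf right_diff_distrib)
  also have "\<dots> \<le> (\<Sum>i\<in>I. a i * dist x y)"
  proof (rule sum_abs[THEN order_trans], rule sum_mono)
    fix i assume i: "i \<in> I"
    then have "\<bar>\<phi> i x - \<phi> i y\<bar> \<le> dist x y"
      using assms(1)[OF i] lipschitz_onD[of 1 UNIV "\<phi> i" x y] by (simp add: Lip1_def dist_real_def)
    then show "\<bar>a i * (\<phi> i x - \<phi> i y)\<bar> \<le> a i * dist x y"
      using assms(2)[OF i] by (simp add: abs_mult mult_left_mono)
  qed
  also have "\<dots> = 1 * dist x y"
    using assms(3) by (simp add: sum_distrib_right[symmetric])
  finally show "dist (\<Sum>i\<in>I. a i * \<phi> i x) (\<Sum>i\<in>I. a i * \<phi> i y) \<le> 1 * dist x y" .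
qed simp

lemma conv_measures_subset_prob_measures:
  assumes "A \<subseteq> prob_measures"
  shows "conv_measures A \<subseteq> prob_measures"
  using assms unfolding conv_measures_def by (auto intro!: mixture_in_prob_measures)

lemma abs_integral_prob_le:
  fixes \<phi> :: "'a::metric_space \<Rightarrow> real"
  assumes K: "compact (UNIV :: 'a set)" and \<nu>: "\<nu> \<in> prob_measures"
    and \<phi>: "continuous_on UNIV \<phi>" "\<And>x. \<bar>\<phi> x\<bar> \<le> b"
  shows "\<bar>integral\<^sup>L \<nu> \<phi>\<bar> \<le> b"
proof -
  interpret prob_space \<nu> using \<nu> by (simp add: prob_measures_def)
  have int: "integrable \<nu> \<phi>"
    by (rule integrable_continuous_prob_measures[OF K \<nu> \<phi>(1)])
  have "\<phi> x \<le> b" "- b \<le> \<phi> x" for x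
    using \<phi>(2)[of x] by linarith+
  then have "integral\<^sup>L \<nu> \<phi> \<le> b" "- b \<le> integral\<^sup>L \<nu> \<phi>"
    by (auto intro!: integral_le_const integral_ge_const int)
  then show ?thesis by linarith
qed

text \<open>Interchange of quantifiers. \<open>approximate_minimax\<close> is applied to the vectors
  of integral differences over a finite net \<open>P\<close>; a weighted sum of these is the
  difference for one convex combination of test functions, and there \<open>sep\<close> supplies the
  measure. Replacing \<phi> by its negative turns the one-sided bounds into the absolute values in
  \<open>W1\<close>.\<close>

lemma ex_conv_measures_W1_le:
  fixes \<mu> :: "'a::metric_space measure"
  assumes K: "compact (UNIV :: 'a set)" and A: "A \<subseteq> prob_measures" and \<mu>: "\<mu> \<in> prob_measures"
    and sep: "\<And>\<phi>. \<phi> \<in> Lip1 \<Longrightarrow> \<exists>\<nu>\<in>A. integral\<^sup>L \<mu> \<phi> - integral\<^sup>L \<nu> \<phi> \<le> c"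
    and \<eta>: "0 < \<eta>"
  shows "\<exists>\<nu>\<in>conv_measures A. W1 \<mu> \<nu> \<le> c + \<eta>"
proof -
  obtain P :: "('a \<Rightarrow> real) set" where P: "finite P" "P \<subseteq> Lip1"
    "\<And>\<phi>. \<phi> \<in> Lip1 \<Longrightarrow> \<exists>\<psi>\<in>P. \<exists>c. \<forall>x. \<bar>\<phi> x - \<psi> x - c\<bar> \<le> \<eta> / 4"
    using Lip1_finite_net[OF K, of "\<eta> / 4"] \<eta> by auto
  define v where "v \<nu> \<psi> = integral\<^sup>L \<mu> \<psi> - integral\<^sup>L \<nu> \<psi>" for \<nu> and \<psi> :: "'a \<Rightarrow> real"
  have "\<exists>b. \<forall>x. \<bar>\<psi> x\<bar> \<le> b" if "\<psi> \<in> P" for \<psi>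
    using compact_imp_bounded[OF compact_continuous_image[OF continuous_on_Lip1 K]] that P(2)
    by (fastforce simp: bounded_iff)
  then obtain b where b: "\<And>\<psi> x. \<psi> \<in> P \<Longrightarrow> \<bar>\<psi> x\<bar> \<le> b \<psi>" by metis
  have cP: "continuous_on UNIV \<psi>" if "\<psi> \<in> P" for \<psi>
    using that P(2) continuous_on_Lip1 by blast
  have int: "integrable \<nu> \<psi>" if "\<nu> \<in> prob_measures" "\<psi> \<in> Lip1" for \<nu> and \<psi> :: "'a \<Rightarrow> real"
    using integrable_continuous_prob_measures[OF K that(1) continuous_on_Lip1[OF that(2)]] .
  have conv: "conv_measures A \<subseteq> prob_measures"
    by (rule conv_measures_subset_prob_measures[OF A])
  \<comment> \<open>Half of \<eta> is spent here; the other half covers the net error \<eta>/4 at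
    \<mu> and again at \<nu>.\<close>
  have "\<exists>w\<in>v ` conv_measures A. \<forall>\<psi>\<in>P. w \<psi> \<le> c + \<eta> / 2"
  proof (rule approximate_minimax[where V = "v ` A" and B = "\<lambda>\<psi>. b \<psi> + b \<psi>"])
    show "finite P" by fact
    have "(\<lambda>x. 0) \<in> (Lip1 :: ('a \<Rightarrow> real) set)"
      by (simp add: Lip1_def lipschitz_on_def)
    then obtain \<nu>\<^sub>0 where "\<nu>\<^sub>0 \<in> A" using sep by blast
    then have "mixture {..<1::nat} (\<lambda>_. 1) (\<lambda>_. \<nu>\<^sub>0) \<in> conv_measures A"
      unfolding conv_measures_def by (intro CollectI exI[of _ 1] exI[of _ "\<lambda>_. 1"] exI[of _ "\<lambda>_. \<nu>\<^sub>0"]) simp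
    then show "v ` conv_measures A \<noteq> {}" by blast
  next
    fix p u and t :: real assume "p \<in> v ` conv_measures A" "u \<in> v ` A" and t: "0 \<le> t" "t \<le> 1"
    then obtain \<nu> \<rho> where \<nu>: "\<nu> \<in> conv_measures A" "p = v \<nu>" and \<rho>: "\<rho> \<in> A" "u = v \<rho>" by blast
    obtain n :: nat and w m where n: "\<nu> = mixture {..<n} w m" "\<And>i. i < n \<Longrightarrow> 0 \<le> w i" "\<And>i. i < n \<Longrightarrow> m i \<in> A" "(\<Sum>i<n. w i) = 1"
      using \<nu>(1) unfolding conv_measures_def by blast
    \<comment> \<open>The mixture is lengthened by one term: the old weights shrink by the factor
      \<open>1 - t\<close>, and \<rho> enters at index \<open>n\<close> with weight
      \<open>t\<close>.\<close>
    define w' where "w' i = (if i < n then (1 - t) * w i else t)" for i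
    define m' where "m' i = (if i < n then m i else \<rho>)" for i
    have w': "\<And>i. 0 \<le> w' i" "(\<Sum>i<Suc n. w' i) = 1"
      using n t by (auto simp: w'_def sum_distrib_left[symmetric])
    have m': "\<And>i. m' i \<in> A"
      using n \<rho> by (auto simp: m'_def)
    have mem: "mixture {..<Suc n} w' m' \<in> conv_measures A"
      unfolding conv_measures_def using w' m' by blast
    have "v (mixture {..<Suc n} w' m') \<psi> = (1 - t) * p \<psi> + t * u \<psi>" if \<psi>: "\<psi> \<in> P" for \<psi>
    proof -
      have meas: "\<psi> \<in> borel_measurable borel"
        by (rule borel_measurable_continuous_onI[OF cP[OF \<psi>]])
      have A': "sets \<kappa> = sets borel" "integrable \<kappa> \<psi>" if "\<kappa> \<in> A" for \<kappa>
        using that A \<psi> P(2) by (auto simp: prob_measures_def intro!: int)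
      have "integral\<^sup>L (mixture {..<Suc n} w' m') \<psi> = (\<Sum>i<Suc n. w' i * integral\<^sup>L (m' i) \<psi>)"
        using w' m' A' meas by (intro integral_mixture) auto
      also have "\<dots> = (1 - t) * (\<Sum>i<n. w i * integral\<^sup>L (m i) \<psi>) + t * integral\<^sup>L \<rho> \<psi>"
        by (simp add: w'_def m'_def sum_distrib_left mult.assoc)
      also have "(\<Sum>i<n. w i * integral\<^sup>L (m i) \<psi>) = integral\<^sup>L \<nu> \<psi>"
        unfolding n(1) using n A' meas by (intro integral_mixture[symmetric]) auto
      finally show ?thesis
        by (simp add: \<nu>(2) \<rho>(2) v_def algebra_simps)
    qed
    with mem show "\<exists>v'\<in>v ` conv_measures A. \<forall>\<psi>\<in>P. v' \<psi> = (1 - t) * p \<psi> + t * u \<psi>" by blast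
  next
    fix p \<psi> assume "p \<in> v ` conv_measures A \<union> v ` A" and \<psi>: "\<psi> \<in> P"
    then obtain \<nu> where "\<nu> \<in> prob_measures" "p \<psi> = v \<nu> \<psi>" using A conv by blast
    then show "\<bar>p \<psi>\<bar> \<le> b \<psi> + b \<psi>"
      using abs_integral_prob_le[OF K \<mu> cP[OF \<psi>] b[OF \<psi>]] abs_integral_prob_le[OF K _ cP[OF \<psi>] b[OF \<psi>], of \<nu>]
      unfolding v_def by simp
  next
    fix a :: "('a \<Rightarrow> real) \<Rightarrow> real" assume a: "\<And>\<psi>. \<psi> \<in> P \<Longrightarrow> 0 \<le> a \<psi>" "(\<Sum>\<psi>\<in>P. a \<psi>) = 1"
    have "(\<lambda>x. \<Sum>\<psi>\<in>P. a \<psi> * \<psi> x) \<in> Lip1"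
      using P(2) a by (intro convex_combination_in_Lip1) auto
    then obtain \<nu> where \<nu>: "\<nu> \<in> A"
      "integral\<^sup>L \<mu> (\<lambda>x. \<Sum>\<psi>\<in>P. a \<psi> * \<psi> x) - integral\<^sup>L \<nu> (\<lambda>x. \<Sum>\<psi>\<in>P. a \<psi> * \<psi> x) \<le> c"
      using sep by blast
    have "integral\<^sup>L \<kappa> (\<lambda>x. \<Sum>\<psi>\<in>P. a \<psi> * \<psi> x) = (\<Sum>\<psi>\<in>P. a \<psi> * integral\<^sup>L \<kappa> \<psi>)" if "\<kappa> \<in> prob_measures" for \<kappa>
      using int[OF that] P(2) by (subst Bochner_Integration.integral_sum) auto
    then have "(\<Sum>\<psi>\<in>P. a \<psi> * v \<nu> \<psi>) \<le> c"
      using \<nu> \<mu> A by (auto simp: v_def right_diff_distrib sum_subtractf)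
    with \<nu>(1) show "\<exists>u\<in>v ` A. (\<Sum>\<psi>\<in>P. a \<psi> * u \<psi>) \<le> c" by blast
  qed (use \<eta> in simp)
  then obtain \<nu> where \<nu>: "\<nu> \<in> conv_measures A" "\<And>\<psi>. \<psi> \<in> P \<Longrightarrow> v \<nu> \<psi> \<le> c + \<eta> / 2"
    by blast
  have \<nu>_prob: "\<nu> \<in> prob_measures" using \<nu>(1) conv by blast
  have le: "v \<nu> \<phi> \<le> c + \<eta>" if \<phi>: "\<phi> \<in> Lip1" for \<phi>
  proof -
    obtain \<psi> d where \<psi>: "\<psi> \<in> P" "\<And>x. \<bar>\<phi> x - \<psi> x - d\<bar> \<le> \<eta> / 4"
      using P(3)[OF \<phi>] by blast
    \<comment> \<open>The constant \<open>d\<close> shifts the integrals over all probability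
      measures alike, so it cancels in \<open>v\<close>.\<close>
    have near: "\<bar>integral\<^sup>L \<kappa> \<phi> - integral\<^sup>L \<kappa> \<psi> - d\<bar> \<le> \<eta> / 4" if \<kappa>: "\<kappa> \<in> prob_measures" for \<kappa>
    proof -
      interpret prob_space \<kappa> using \<kappa> by (simp add: prob_measures_def)
      have "integral\<^sup>L \<kappa> (\<lambda>x. \<phi> x - \<psi> x - d) = integral\<^sup>L \<kappa> \<phi> - integral\<^sup>L \<kappa> \<psi> - d"
        using int[OF \<kappa> \<phi>] int[OF \<kappa>, of \<psi>] \<psi>(1) P(2) by (auto simp: prob_space)
      moreover have "\<bar>integral\<^sup>L \<kappa> (\<lambda>x. \<phi> x - \<psi> x - d)\<bar> \<le> \<eta> / 4"
        by (rule abs_integral_prob_le[OF K \<kappa> _ \<psi>(2)])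
          (intro continuous_intros continuous_on_Lip1[OF \<phi>] cP[OF \<psi>(1)])
      ultimately show ?thesis by simp
    qed
    show ?thesis
      using near[OF \<mu>] near[OF \<nu>_prob] \<nu>(2)[OF \<psi>(1)] unfolding v_def by linarith
  qed
  have "\<bar>integral\<^sup>L \<mu> \<phi> - integral\<^sup>L \<nu> \<phi>\<bar> \<le> c + \<eta>" if \<phi>: "\<phi> \<in> Lip1" for \<phi>
    using le[OF \<phi>] le[OF uminus_in_Lip1[OF \<phi>]] by (simp add: v_def abs_le_iff)
  moreover have "(Lip1 :: ('a \<Rightarrow> real) set) \<noteq> {}"
    by (auto simp: Lip1_def lipschitz_on_def intro!: exI[of _ "\<lambda>_. 0"])
  ultimately have "W1 \<mu> \<nu> \<le> c + \<eta>"
    unfolding W1_def by (intro cSUP_least) auto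
  with \<nu>(1) show ?thesis by blast
qed

subsection \<open>Time averages\<close>

lemma continuous_on_funpow:
  fixes f :: "'a::topological_space \<Rightarrow> 'a"
  assumes f: "continuous_on UNIV f"
  shows "continuous_on UNIV (f ^^ k)"
proof (induction k)
  case 0
  show ?case by (simp add: continuous_on_id id_def)
next
  case (Suc k)
  then show ?case
    using continuous_on_compose[OF Suc continuous_on_subset[OF f]] by simp
qed

lemma integral_comp_funpow_invariant:
  fixes \<phi> :: "'a::metric_space \<Rightarrow> real"
  assumes f: "continuous_on UNIV f" and \<mu>: "\<mu> \<in> inv_measures f" and \<phi>: "continuous_on UNIV \<phi>"
  shows "integral\<^sup>L \<mu> (\<lambda>x. \<phi> ((f ^^ k) x)) = integral\<^sup>L \<mu> \<phi>"
proof -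
  have \<mu>': "\<mu> \<in> prob_measures" "sets \<mu> = sets borel" "space \<mu> = UNIV"
    using \<mu> by (auto simp: inv_measures_def prob_measures_def dest: sets_eq_imp_space_eq)
  have fm: "f \<in> borel_measurable \<mu>"
    by (rule measurable_prob_measures[OF \<mu>'(1) borel_measurable_continuous_onI[OF f]])
  have "distr \<mu> borel f = \<mu>"
  proof (rule measure_eqI)
    fix A assume "A \<in> sets (distr \<mu> borel f)"
    then show "emeasure (distr \<mu> borel f) A = emeasure \<mu> A"
      using \<mu> fm \<mu>'(3) by (simp add: emeasure_distr inv_measures_def)
  qed (use \<mu>' in simp)
  then have inv: "integral\<^sup>L \<mu> (\<lambda>x. \<psi> (f x)) = integral\<^sup>L \<mu> \<psi>" if "continuous_on UNIV \<psi>" for \<psi> :: "'a \<Rightarrow> real"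
    using integral_distr[OF fm borel_measurable_continuous_onI[OF that]] by simp
  show ?thesis
  proof (induction k)
    case (Suc k)
    have "continuous_on UNIV (\<lambda>x. \<phi> ((f ^^ k) x))"
      by (rule continuous_on_compose2[OF \<phi> continuous_on_funpow[OF f]]) simp
    then show ?case
      using inv[of "\<lambda>x. \<phi> ((f ^^ k) x)"] Suc by (simp add: funpow_swap1)
  qed simp
qed

text \<open>Otherwise the averages \<open>A n x\<close> are eventually below \<open>c\<close> at
  every \<open>x\<close>, so the positive parts of \<open>A n x - c\<close> tend to 0 pointwise and,
  by dominated convergence, in integral. By invariance these integrals are at least
  \<open>integral\<^sup>L \<mu> \<phi> - c > 0\<close> for positive \<open>n\<close>.\<close>

lemma ex_point_frequently_average_ge:
  fixes \<phi> :: "'a::metric_space \<Rightarrow> real"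
  assumes K: "compact (UNIV :: 'a set)" and f: "continuous_on UNIV f" and \<mu>: "\<mu> \<in> inv_measures f"
    and \<phi>: "continuous_on UNIV \<phi>" and c: "c < integral\<^sup>L \<mu> \<phi>"
  shows "\<exists>x. \<exists>\<^sub>F n in sequentially. c \<le> (1 / real n) * (\<Sum>k=1..n. \<phi> ((f ^^ k) x))"
proof (rule ccontr)
  define A where "A n x = (1 / real n) * (\<Sum>k=1..n. \<phi> ((f ^^ k) x))" for n x
  assume "\<not> ?thesis"
  then have small: "\<forall>\<^sub>F n in sequentially. A n x < c" for x
    by (simp add: A_def not_frequently not_le)
  have \<mu>': "\<mu> \<in> prob_measures" using \<mu> by (simp add: inv_measures_def)
  interpret prob_space \<mu> using \<mu>' by (simp add: prob_measures_def)
  obtain B where B: "\<And>x. \<bar>\<phi> x\<bar> \<le> B"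
    using compact_imp_bounded[OF compact_continuous_image[OF \<phi> K]] by (auto simp: bounded_iff)
  have c\<phi>: "continuous_on UNIV (\<lambda>x. \<phi> ((f ^^ k) x))" for k
    by (rule continuous_on_compose2[OF \<phi> continuous_on_funpow[OF f]]) simp
  have int\<phi>: "integrable \<mu> (\<lambda>x. \<phi> ((f ^^ k) x))" for k
    by (rule integrable_continuous_prob_measures[OF K \<mu>' c\<phi>])
  have intA: "integrable \<mu> (A n)" for n
    unfolding A_def using int\<phi> by (intro integrable_mult_right Bochner_Integration.integrable_sum)
  have avg: "integral\<^sup>L \<mu> (A n) = integral\<^sup>L \<mu> \<phi>" if "0 < n" for n
    unfolding A_def using that int\<phi> integral_comp_funpow_invariant[OF f \<mu> \<phi>]
    by (simp add: Bochner_Integration.integral_sum)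
  have bndA: "\<bar>A n x\<bar> \<le> B" for n x
  proof -
    have "0 \<le> B" using B[of x] by linarith
    have "\<bar>\<Sum>k=1..n. \<phi> ((f ^^ k) x)\<bar> \<le> (\<Sum>k=1..n. B)"
      by (rule sum_abs[THEN order_trans]) (intro sum_mono B)
    then show ?thesis
      using \<open>0 \<le> B\<close> by (cases "n = 0") (auto simp: A_def abs_mult field_simps)
  qed
  have "(\<lambda>n. integral\<^sup>L \<mu> (\<lambda>x. max 0 (A n x - c))) \<longlonglongrightarrow> integral\<^sup>L \<mu> (\<lambda>x. 0)"
  proof (rule integral_dominated_convergence[where w = "\<lambda>_. B + \<bar>c\<bar>"])
    show "AE x in \<mu>. (\<lambda>n. max 0 (A n x - c)) \<longlonglongrightarrow> 0"
    proof (rule AE_I2, rule tendsto_eventually)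
      fix x show "\<forall>\<^sub>F n in sequentially. max 0 (A n x - c) = 0"
        using small[of x] by eventually_elim simp
    qed
    show "AE x in \<mu>. norm (max 0 (A n x - c)) \<le> B + \<bar>c\<bar>" for n
    proof (rule AE_I2)
      fix x show "norm (max 0 (A n x - c)) \<le> B + \<bar>c\<bar>"
        using bndA[of n x] by (simp add: max_def) linarith
    qed
    show "(\<lambda>x. max 0 (A n x - c)) \<in> borel_measurable \<mu>" for n
      using intA[of n] by (intro borel_measurable_max borel_measurable_diff) auto
  qed auto
  moreover have "integral\<^sup>L \<mu> \<phi> - c \<le> integral\<^sup>L \<mu> (\<lambda>x. max 0 (A n x - c))" if "0 < n" for n
  proof -
    have "integral\<^sup>L \<mu> \<phi> - c = integral\<^sup>L \<mu> (\<lambda>x. A n x - c)"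
      using intA[of n] avg[OF that] by (simp add: prob_space)
    also have "\<dots> \<le> integral\<^sup>L \<mu> (\<lambda>x. max 0 (A n x - c))"
      using intA[of n] by (intro integral_mono) auto
    finally show ?thesis .
  qed
  ultimately have "integral\<^sup>L \<mu> \<phi> - c \<le> 0"
    by (intro LIMSEQ_le_const) (auto intro!: exI[of _ 1])
  with c show False by simp
qed

section \<open>Limit measures along trajectories of a method\<close>

lemma trajectory_eq_comp_upto: "trajectory g y \<Longrightarrow> y k = comp_upto g k (y 0)"
  by (induction k) (auto simp: trajectory_def)

text \<open>The times with a large average form an infinite set \<open>J\<close>; a weakly
  convergent subsequence of the empirical measures along \<open>J\<close> has its limit in
  \<open>M0_point\<close>, and the bound passes to the limit.\<close>

lemma ex_M0_point_integral_ge: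
  fixes \<phi> :: "'a::metric_space \<Rightarrow> real"
  assumes K: "compact (UNIV :: 'a set)" and \<phi>: "continuous_on UNIV \<phi>"
    and y: "trajectory g y"
    and freq: "\<exists>\<^sub>F n in sequentially. c \<le> (1 / real n) * (\<Sum>k=1..n. \<phi> (y k))"
  shows "\<exists>\<nu>\<in>M0_point g (y 0). c \<le> integral\<^sup>L \<nu> \<phi>"
proof -
  obtain B where B: "\<And>x. \<bar>\<phi> x\<bar> \<le> B"
    using compact_imp_bounded[OF compact_continuous_image[OF \<phi> K]] by (auto simp: bounded_iff)
  define J where "J = {n. c \<le> (1 / real n) * (\<Sum>k=1..n. \<phi> (y k)) \<and> 1 \<le> n}"
  have "\<exists>\<^sub>F n in sequentially. n \<in> J"
    unfolding J_def mem_Collect_eq by (rule frequently_eventually_conj[OF freq eventually_ge_at_top, THEN frequently_elim1]) auto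
  then have "infinite J"
    by (simp add: frequently_cofinite cofinite_eq_sequentially[symmetric])
  then obtain s :: "nat \<Rightarrow> nat" where s: "strict_mono s" "\<And>j. s j \<in> J"
    using infinite_enumerate by blast
  have "empirical g (y 0) (s j) \<in> prob_measures" for j
    using s(2)[of j] by (intro empirical_in_prob_measures) (simp add: J_def)
  then obtain r \<nu> where r: "strict_mono (r :: nat \<Rightarrow> nat)" and \<nu>: "\<nu> \<in> prob_measures"
    and conv: "\<And>\<psi>. continuous_on UNIV (\<psi> :: 'a \<Rightarrow> real) \<Longrightarrow>
      (\<lambda>j. integral\<^sup>L (empirical g (y 0) (s (r j))) \<psi>) \<longlonglongrightarrow> integral\<^sup>L \<nu> \<psi>"
    using weak_conv_subseq[OF K, of "\<lambda>j. empirical g (y 0) (s j)"] by blast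
  have sr: "strict_mono (\<lambda>j. s (r j))"
    using strict_mono_o[OF s(1) r] by (simp add: comp_def)
  have "\<nu> \<in> M0_point g (y 0)"
    using limit_of_empirical_in_M0_point[OF sr \<nu> conv] .
  moreover have "c \<le> integral\<^sup>L \<nu> \<phi>"
  proof (rule LIMSEQ_le[OF _ conv[OF \<phi>]])
    have "(\<lambda>n. c - 2 * B / real n) \<longlonglongrightarrow> c - 0"
      by (intro tendsto_intros tendsto_divide_0[OF tendsto_const] filterlim_real_at_infinity_sequentially
          filterlim_at_top_imp_at_infinity filterlim_real_sequentially)
    then show "(\<lambda>j. c - 2 * B / real (s (r j))) \<longlonglongrightarrow> c"
      using LIMSEQ_subseq_LIMSEQ[OF _ sr] by (simp add: comp_def)
    \<comment> \<open>The averages in \<open>EIS\<close> run over 1 to \<open>n\<close>, the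
      empirical measure over 0 to \<open>n - 1\<close>. The sums differ by
      \<open>\<phi> (y n) - \<phi> (y 0)\<close>, at most \<open>2 * B\<close>, an error that
      vanishes after division by \<open>n\<close>.\<close>
    have "c - 2 * B / real n \<le> integral\<^sup>L (empirical g (y 0) n) \<phi>" if "n \<in> J" for n
    proof -
      have n: "1 \<le> n" "c \<le> (1 / real n) * (\<Sum>k=1..n. \<phi> (y k))"
        using that by (auto simp: J_def)
      have "(\<Sum>k<Suc n. \<phi> (y k)) = \<phi> (y 0) + (\<Sum>k=1..n. \<phi> (y k))"
        by (simp only: sum.lessThan_Suc_shift) (simp add: sum.atLeast1_atMost_eq)
      then have "(\<Sum>k=1..n. \<phi> (y k)) \<le> (\<Sum>k<n. \<phi> (y k)) + 2 * B"
        using B[of "y 0"] B[of "y n"] by (simp add: abs_le_iff)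
      then have "(1 / real n) * (\<Sum>k=1..n. \<phi> (y k)) \<le> (1 / real n) * ((\<Sum>k<n. \<phi> (y k)) + 2 * B)"
        by (intro mult_left_mono) auto
      also have "\<dots> = integral\<^sup>L (empirical g (y 0) n) \<phi> + 2 * B / real n"
        unfolding integral_empirical[OF K \<phi>] trajectory_eq_comp_upto[OF y, symmetric]
        by (simp add: distrib_left add_divide_distrib)
      finally show ?thesis using n(2) by linarith
    qed
    then show "\<exists>N. \<forall>j\<ge>N. c - 2 * B / real (s (r j)) \<le> integral\<^sup>L (empirical g (y 0) (s (r j))) \<phi>"
      using s(2) by blast
  qed
  ultimately show ?thesis by blast
qed

section \<open>From inverse shadowing to invariant measures\<close>

lemma M0_subset_prob_measures: "M0 g \<subseteq> prob_measures"
  using closure_of_subset_topspace[of weak_star] unfolding M0_def M0_point_def topspace_weak_star by blast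

theorem theorem3p1:
  fixes f :: "'a::metric_space \<Rightarrow> 'a"
  assumes "compact (UNIV :: 'a set)"
    and "continuous_on UNIV f"
    and "surj f"
    and "EIS f"
  shows "\<forall>\<epsilon>>0. \<exists>d>0. \<forall>g. is_d_method d f g \<longrightarrow> inv_measures f \<subseteq> W1_nbhd \<epsilon> (limit_measures g)"
proof (intro allI impI)
  fix \<epsilon> :: real assume "0 < \<epsilon>"
  then have "0 < \<epsilon> / 4" by simp
  then obtain d where "0 < d" and d: "\<And>x g. is_d_method d f g \<Longrightarrow> \<exists>y. trajectory g y \<and>
        (\<forall>\<phi>\<in>Lip1. limsup (\<lambda>n. ereal ((1 / real n) * (\<Sum>k=1..n. \<phi> ((f ^^ k) x) - \<phi> (y k)))) \<le> ereal (\<epsilon> / 4))"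
    using assms(4) unfolding EIS_def by meson
  have "\<mu> \<in> W1_nbhd \<epsilon> (limit_measures g)" if g: "is_d_method d f g" and \<mu>: "\<mu> \<in> inv_measures f" for g \<mu>
  proof -
    have \<mu>': "\<mu> \<in> prob_measures" using \<mu> by (simp add: inv_measures_def)
    \<comment> \<open>The point \<open>x\<close>, and with it the start \<open>y 0\<close>, is
      chosen for \<phi>, so \<nu> ranges over limit points for different starts. The loss is
      \<epsilon>/4 from the choice of \<open>x\<close> plus \<epsilon>/2 from shadowing.\<close>
    have "\<exists>\<nu>\<in>M0 g. integral\<^sup>L \<mu> \<phi> - integral\<^sup>L \<nu> \<phi> \<le> 3 * \<epsilon> / 4" if \<phi>: "\<phi> \<in> Lip1" for \<phi>
    proof -
      note c\<phi> = continuous_on_Lip1[OF \<phi>]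
      obtain x where x: "\<exists>\<^sub>F n in sequentially. integral\<^sup>L \<mu> \<phi> - \<epsilon> / 4 \<le> (1 / real n) * (\<Sum>k=1..n. \<phi> ((f ^^ k) x))"
        using ex_point_frequently_average_ge[OF assms(1,2) \<mu> c\<phi>, of "integral\<^sup>L \<mu> \<phi> - \<epsilon> / 4"] \<open>0 < \<epsilon>\<close> by auto
      obtain y where y: "trajectory g y"
        "limsup (\<lambda>n. ereal ((1 / real n) * (\<Sum>k=1..n. \<phi> ((f ^^ k) x) - \<phi> (y k)))) \<le> ereal (\<epsilon> / 4)"
        using d[OF g] \<phi> by meson
      \<comment> \<open>\<epsilon>/4 is raised to \<epsilon>/2, because a strict bound on the limsup
        gives an eventual bound on the averages.\<close>
      have "limsup (\<lambda>n. ereal ((1 / real n) * (\<Sum>k=1..n. \<phi> ((f ^^ k) x) - \<phi> (y k)))) < ereal (\<epsilon> / 2)"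
        using \<open>0 < \<epsilon>\<close> by (intro order_le_less_trans[OF y(2)]) simp
      then have "\<forall>\<^sub>F n in sequentially. (1 / real n) * (\<Sum>k=1..n. \<phi> ((f ^^ k) x) - \<phi> (y k)) < \<epsilon> / 2"
        by (auto dest!: Limsup_lessD)
      \<comment> \<open>The averages along \<open>f\<close> are large infinitely often and the
        comparison holds eventually, so both hold together infinitely often.\<close>
      with x have "\<exists>\<^sub>F n in sequentially. integral\<^sup>L \<mu> \<phi> - 3 * \<epsilon> / 4 \<le> (1 / real n) * (\<Sum>k=1..n. \<phi> (y k))"
        by (rule frequently_eventually_conj[THEN frequently_elim1]) (simp add: sum_subtractf right_diff_distrib)
      then obtain \<nu> where "\<nu> \<in> M0_point g (y 0)" "integral\<^sup>L \<mu> \<phi> - 3 * \<epsilon> / 4 \<le> integral\<^sup>L \<nu> \<phi>"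
        using ex_M0_point_integral_ge[OF assms(1) c\<phi> y(1)] by blast
      then show ?thesis
        by (intro bexI[of _ \<nu>]) (auto simp: M0_def)
    qed
    \<comment> \<open>The total \<open>3 * \<epsilon> / 4 + \<epsilon> / 8\<close> stays strictly
      below \<epsilon>, as \<open>W1_nbhd\<close> demands.\<close>
    then obtain \<nu> where \<nu>: "\<nu> \<in> conv_measures (M0 g)" "W1 \<mu> \<nu> \<le> 3 * \<epsilon> / 4 + \<epsilon> / 8"
      using ex_conv_measures_W1_le[OF assms(1) M0_subset_prob_measures \<mu>', of g "3 * \<epsilon> / 4" "\<epsilon> / 8"] \<open>0 < \<epsilon>\<close> by auto
    have "\<nu> \<in> limit_measures g"
      unfolding limit_measures_def
      using closure_of_subset[of "conv_measures (M0 g)" weak_star] \<nu>(1)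
        conv_measures_subset_prob_measures[OF M0_subset_prob_measures] by (auto simp: topspace_weak_star)
    then show ?thesis
      using \<nu>(2) \<mu>' \<open>0 < \<epsilon>\<close> unfolding W1_nbhd_def by force
  qed
  with \<open>0 < d\<close> show "\<exists>d>0. \<forall>g. is_d_method d f g \<longrightarrow> inv_measures f \<subseteq> W1_nbhd \<epsilon> (limit_measures g)"
    by blast
qed

end
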